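(* For every nonnegative integer $n$, \[ B_n(y,1,q)=\frac{1}{(1-q)^n}\sum_{j=0}^n(-1)^j\left(\sum_{i=0}^{2n-2j}y^i\binom{n}{j+\lceil i/2\rceil}\binom{n}{\lfloor i/2\rfloor}\right)\left(\sum_{\ell=0}^{2j}y^\ell q^{\ell(2j-\ell+1)/2}\right), \] and equivalently \[ B_n(y,1,q)=\frac{1}{(1-q)^n}\sum_{k=0}^n\left(\sum_{i=0}^{n-k}y^{2i}\Big(\tbinom ni\tbinom n{i+k}-\tbinom n{i-1}\tbinom n{i+k+1}\Big)\right)\sum_{j=0}^k y^{k-j}(-1)^j\sum_{\ell=0}^{2j}y^\ell q^{\ell(2j-\ell+1)/2}. \]
   Context: Binomial coefficients $\binom ab$ with $b<0$ or $b>a$ are $0$. A Ferrers diagram is a top- and left-justified array of unit cells with weakly decreasing row lengths (empty rows and columns allowed); its length is the number of rows plus the number of columns. For a Ferrers diagram $F$ with $k$ columns, the shifted diagram $\overline F$ is obtained by adding above $F$ $k$ new left-justified rows of lengths $1,2,\dots,k$ (top to bottom); the rightmost cell of an added row is a diagonal cell. The length of $\overline F$ is that of $F$. A type $B$ permutation tableau of length $n$ is a $0,1$-filling of such an $\overline F$ of length $n$ with (1) each column containing a $1$; (2) no $0$ having both a $1$ above it in its column and a $1$ to its left in its row; (3) no $0$ in a diagonal cell having a $1$ to its left in its row. $\mathrm{PT}_B(n)$ denotes the set of these. For $T$: $\operatorname{so}(T)$ is the number of $1$'s having a $1$ above them in the same column, $\operatorname{row}(T)$ the number of rows of $F$ (added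 rows excluded), $\operatorname{diag}(T)$ the number of $1$'s in diagonal cells. $B_n(y,t,q)=\sum_{T\in\mathrm{PT}_B(n)}y^{2\operatorname{row}(T)+\operatorname{diag}(T)}t^{\operatorname{diag}(T)}q^{\operatorname{so}(T)}$. *)

theory Defs
  imports Main
begin

text \<open>A Ferrers diagram is a pair \<open>(k, rs)\<close>: the number \<open>k\<close> of columns and the list \<open>rs\<close> of row
  lengths from top to bottom. Both are needed because empty rows and empty columns are allowed.\<close>

type_synonym ferrers = "nat \<times> nat list"

definition is_ferrers :: "ferrers \<Rightarrow> bool" where
  "is_ferrers = (\<lambda>(k, rs). sorted_wrt (\<ge>) rs \<and> (\<forall>r\<in>set rs. r \<le> k))"

definition ferrers_length :: "ferrers \<Rightarrow> nat" where
  "ferrers_length = (\<lambda>(k, rs). length rs + k)"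

text \<open>Cells are pairs (row, column), both counted from 0, with row 0 at the top. The added rows
  of the shifted diagram are rows \<open>0, \<dots>, k - 1\<close>; row \<open>i < k\<close> has length \<open>i + 1\<close>, hence its
  rightmost cell is \<open>(i, i)\<close>.\<close>

definition shifted_row_lengths :: "ferrers \<Rightarrow> nat list" where
  "shifted_row_lengths = (\<lambda>(k, rs). [1..<k + 1] @ rs)"

definition shifted_cells :: "ferrers \<Rightarrow> (nat \<times> nat) set" where
  "shifted_cells F = {(i, j). i < length (shifted_row_lengths F) \<and> j < shifted_row_lengths F ! i}"

definition diagonal_cells :: "ferrers \<Rightarrow> (nat \<times> nat) set" where
  "diagonal_cells = (\<lambda>(k, rs). {(i, i) | i. i < k})"

text \<open>A 0,1-filling of the shifted diagram is given by its set \<open>S\<close> of cells containing a 1.\<close>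

definition one_above :: "(nat \<times> nat) set \<Rightarrow> nat \<times> nat \<Rightarrow> bool" where
  "one_above S = (\<lambda>(i, j). \<exists>i'<i. (i', j) \<in> S)"

definition one_left :: "(nat \<times> nat) set \<Rightarrow> nat \<times> nat \<Rightarrow> bool" where
  "one_left S = (\<lambda>(i, j). \<exists>j'<j. (i, j') \<in> S)"

type_synonym tableau = "ferrers \<times> (nat \<times> nat) set"

definition PT_B :: "nat \<Rightarrow> tableau set" where
  "PT_B n = {(F, S). is_ferrers F \<and> ferrers_length F = n \<and> S \<subseteq> shifted_cells F \<and>
     (\<forall>j<fst F. \<exists>i. (i, j) \<in> S) \<and>
     (\<forall>c\<in>shifted_cells F - S. \<not> (one_above S c \<and> one_left S c)) \<and>
     (\<forall>c\<in>diagonal_cells F - S. \<not> one_left S c)}"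

definition so_stat :: "tableau \<Rightarrow> nat" where
  "so_stat = (\<lambda>(F, S). card {c \<in> S. one_above S c})"

definition row_stat :: "tableau \<Rightarrow> nat" where
  "row_stat = (\<lambda>((k, rs), S). length rs)"

definition diag_stat :: "tableau \<Rightarrow> nat" where
  "diag_stat = (\<lambda>(F, S). card (S \<inter> diagonal_cells F))"

lemma finite_PT_B: "finite (PT_B n)"
proof -
  let ?Fs = "{..n} \<times> {rs. set rs \<subseteq> {..n} \<and> length rs \<le> n}"
  have fin: "finite (shifted_cells F)" for F
  proof -
    have "shifted_cells F = Sigma {..<length (shifted_row_lengths F)}
        (\<lambda>i. {..<shifted_row_lengths F ! i})"
      by (auto simp: shifted_cells_def)
    then show ?thesis by simp
  qed
  have "PT_B n \<subseteq> Sigma ?Fs (\<lambda>F. Pow (shifted_cells F))"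
    by (force simp: PT_B_def is_ferrers_def ferrers_length_def)
  moreover have "finite ?Fs"
    by (intro finite_cartesian_product finite_lists_length_le) auto
  ultimately show ?thesis
    using fin by (meson finite_SigmaI finite_Pow_iff finite_subset)
qed

definition B_poly :: "nat \<Rightarrow> 'a::comm_semiring_1 \<Rightarrow> 'a \<Rightarrow> 'a \<Rightarrow> 'a" where
  "B_poly n y t q = (\<Sum>T\<in>PT_B n. y ^ (2 * row_stat T + diag_stat T) * t ^ diag_stat T * q ^ so_stat T)"

text \<open>The lower index ranges over the integers because the index \<open>i - 1\<close> is used with \<open>i = 0\<close>.\<close>

definition binom :: "nat \<Rightarrow> int \<Rightarrow> nat" where
  "binom a b = (if b < 0 \<or> b > int a then 0 else a choose nat b)"

end

theory Submission
  imports Defs "HOL-Computational_Algebra.Polynomial"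
    "HOL-Computational_Algebra.Formal_Power_Series"
begin

text \<open>Every nonempty tableau arises from a smaller one by appending an empty row at the bottom or by
  inserting a column at the left, whose 1's avoid the rows that contain a 0 with a 1 above it and the
  added rows whose diagonal cell is 0. Counting the remaining, free rows by a variable \<open>x\<close> gives a
  recurrence involving \<open>x\<close> and \<open>1 + q * x\<close>. With \<open>x = (1 - z) / (1 - q)\<close> it reads
  \<open>g\<^sub>n\<^sub>+\<^sub>1 = (T + 1 + y\<^sup>2) g\<^sub>n\<close> for an operator \<open>T\<close> on polynomials in \<open>z\<close> involving \<open>g(z)\<close> and
  \<open>g(q * z)\<close>, and \<open>B\<^sub>n\<close> is obtained at \<open>z = q\<close>.

  Put \<open>h\<^sub>0 = 1\<close> and \<open>h\<^sub>k\<^sub>+\<^sub>1 = T h\<^sub>k - y\<^sup>2 h\<^sub>k\<^sub>-\<^sub>1\<close>. Then \<open>g\<^sub>n\<close> is a combination of the \<open>h\<^sub>k\<close> whose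
  coefficients count weighted Motzkin path prefixes, which are given by the reflection principle.
  The series \<open>H(z, w) = \<Sum>h\<^sub>k(z) w\<^sup>k\<close> satisfies a first-order \<open>q\<close>-difference equation in \<open>z\<close>; a
  Zeilberger-type certificate turns it into one in \<open>w\<close>, which at \<open>z = q\<close> is also satisfied by
  \<open>(\<Sum>\<^sub>j (-w)\<^sup>j \<Sum>\<^sub>l y\<^sup>l q\<^bsup>l(2j-l+1)/2\<^esup>) / (1 - y w)\<close>.\<close>

section \<open>Building tableaux row by row and column by column\<close>

lemma shifted_cells_iff:
  "(i, j) \<in> shifted_cells (k, rs) \<longleftrightarrow>
     i < k + length rs \<and> j < (if i < k then Suc i else rs ! (i - k))"
  by (auto simp: shifted_cells_def shifted_row_lengths_def nth_append simp del: upt_Suc)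

lemma diagonal_cells_iff: "(i, j) \<in> diagonal_cells (k, rs) \<longleftrightarrow> i = j \<and> i < k"
  by (auto simp: diagonal_cells_def)

lemma one_above_iff: "one_above S (i, j) \<longleftrightarrow> (\<exists>i'<i. (i', j) \<in> S)"
  by (simp add: one_above_def)

lemma one_left_iff: "one_left S (i, j) \<longleftrightarrow> (\<exists>j'<j. (i, j') \<in> S)"
  by (simp add: one_left_def)

lemma PT_B_iff:
  "((k, rs), S) \<in> PT_B n \<longleftrightarrow>
     sorted_wrt (\<ge>) rs \<and> (\<forall>r\<in>set rs. r \<le> k) \<and> length rs + k = n \<and>
     S \<subseteq> shifted_cells (k, rs) \<and> (\<forall>j<k. \<exists>i. (i, j) \<in> S) \<and>
     (\<forall>i j. (i, j) \<in> shifted_cells (k, rs) \<longrightarrow> (i, j) \<notin> S \<longrightarrow>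
        \<not> (one_above S (i, j) \<and> one_left S (i, j))) \<and>
     (\<forall>i<k. (i, i) \<notin> S \<longrightarrow> \<not> one_left S (i, i))"
  by (auto simp: PT_B_def is_ferrers_def ferrers_length_def diagonal_cells_def)

lemma finite_shifted_cells: "finite (shifted_cells F)"
proof -
  have "shifted_cells F = Sigma {..<length (shifted_row_lengths F)}
      (\<lambda>i. {..<shifted_row_lengths F ! i})"
    by (auto simp: shifted_cells_def)
  then show ?thesis by simp
qed

lemma finite_PT_B_filling: "(F, S) \<in> PT_B n \<Longrightarrow> finite S"
  by (auto simp: PT_B_def intro: finite_subset[OF _ finite_shifted_cells])

text \<open>The rows in which a column inserted at the left may carry a 1.\<close>

definition free_rows :: "tableau \<Rightarrow> nat set" where
  "free_rows = (\<lambda>((k, rs), S). {i. i < k + length rs \<and> (i < k \<longrightarrow> (i, i) \<in> S) \<and>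
     (\<forall>j. (i, j) \<in> shifted_cells (k, rs) \<longrightarrow> (i, j) \<notin> S \<longrightarrow> \<not> one_above S (i, j))})"

lemma free_rows_iff:
  "i \<in> free_rows ((k, rs), S) \<longleftrightarrow> i < k + length rs \<and> (i < k \<longrightarrow> (i, i) \<in> S) \<and>
     (\<forall>j. (i, j) \<in> shifted_cells (k, rs) \<longrightarrow> (i, j) \<notin> S \<longrightarrow> \<not> one_above S (i, j))"
  by (simp add: free_rows_def)

lemma finite_free_rows: "finite (free_rows T)"
proof -
  obtain k rs S where T: "T = ((k, rs), S)" by (metis prod.exhaust)
  have "free_rows T \<subseteq> {..<k + length rs}" by (auto simp: T free_rows_iff)
  then show ?thesis by (rule finite_subset) simp
qed

definition add_row :: "tableau \<Rightarrow> tableau" where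
  "add_row = (\<lambda>((k, rs), S). ((k, rs @ [0]), S))"

text \<open>The new column also brings a new top row with the single cell \<open>(0, 0)\<close>, so
  old cells move diagonally by one. The rows in \<open>C\<close> are numbered in the enlarged
  diagram, where row 0 is the new diagonal cell.\<close>

definition add_column :: "tableau \<Rightarrow> nat set \<Rightarrow> tableau" where
  "add_column = (\<lambda>((k, rs), S) C.
     ((Suc k, map Suc rs), map_prod Suc Suc ` S \<union> (\<lambda>i. (i, 0)) ` C))"

lemma shifted_cells_add_row: "shifted_cells (k, rs @ [0]) = shifted_cells (k, rs)"
  by (auto simp: shifted_cells_iff nth_append split: if_splits)

lemma add_row_in_PT_B_iff: "add_row T \<in> PT_B (Suc n) \<longleftrightarrow> T \<in> PT_B n"
  by (cases T rule: prod.exhaust, rename_tac F S, case_tac F)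
    (auto simp: add_row_def PT_B_iff shifted_cells_add_row sorted_wrt_append)

lemma inj_add_row: "inj add_row"
  by (auto simp: inj_def add_row_def)

lemma free_rows_add_row:
  "free_rows (add_row ((k, rs), S)) = insert (k + length rs) (free_rows ((k, rs), S))"
  by (auto simp: add_row_def free_rows_iff shifted_cells_add_row)
    (auto simp: shifted_cells_iff)

lemma card_free_rows_add_row: "card (free_rows (add_row T)) = Suc (card (free_rows T))"
proof -
  obtain k rs S where T: "T = ((k, rs), S)" by (metis prod.exhaust)
  have "k + length rs \<notin> free_rows T" by (simp add: T free_rows_iff)
  then show ?thesis
    using finite_free_rows[of T] by (simp add: T free_rows_add_row)
qed

lemma stats_add_row:
  "row_stat (add_row T) = Suc (row_stat T)"
  "diag_stat (add_row T) = diag_stat T"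
  "so_stat (add_row T) = so_stat T"
  by (auto simp: add_row_def row_stat_def diag_stat_def so_stat_def diagonal_cells_def
      split: prod.splits)

lemma shifted_cells_add_column:
  "(Suc i, Suc j) \<in> shifted_cells (Suc k, map Suc rs) \<longleftrightarrow> (i, j) \<in> shifted_cells (k, rs)"
  "(0, Suc j) \<notin> shifted_cells (Suc k, map Suc rs)"
  "(i, 0) \<in> shifted_cells (Suc k, map Suc rs) \<longleftrightarrow> i < Suc (k + length rs)"
  by (auto simp: shifted_cells_iff)

context
  fixes S :: "(nat \<times> nat) set" and C :: "nat set" and S'
  defines "S' \<equiv> map_prod Suc Suc ` S \<union> (\<lambda>i. (i, 0)) ` C"
begin

lemma mem_add_column:
  "(Suc i, Suc j) \<in> S' \<longleftrightarrow> (i, j) \<in> S" "(0, Suc j) \<notin> S'" "(i, 0) \<in> S' \<longleftrightarrow> i \<in> C"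
  by (auto simp: S'_def)

lemma one_above_add_column:
  "one_above S' (i, 0) \<longleftrightarrow> (\<exists>c\<in>C. c < i)"
  "one_above S' (Suc i, Suc j) \<longleftrightarrow> one_above S (i, j)"
  "\<not> one_above S' (0, j)"
  by (auto simp: one_above_iff mem_add_column less_Suc_eq_0_disj)

lemma one_left_add_column:
  "\<not> one_left S' (i, 0)"
  "one_left S' (Suc i, Suc j) \<longleftrightarrow> one_left S (i, j) \<or> Suc i \<in> C"
  by (auto simp: one_left_iff mem_add_column less_Suc_eq_0_disj)

text \<open>A 1 in row \<open>Suc i\<close> of the new column stands to the left of the whole old
  row \<open>i\<close>. This is harmless exactly when that row has no 0 below a 1 and no 0 in a
  diagonal cell, that is, when it is free. Cells of the new column have nothing to their left, and
  row 0 has no other cell.\<close>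

lemma add_column_in_PT_B_iff_aux:
  "((Suc k, map Suc rs), S') \<in> PT_B (Suc n) \<longleftrightarrow>
     ((k, rs), S) \<in> PT_B n \<and> C \<noteq> {} \<and> C \<subseteq> insert 0 (Suc ` free_rows ((k, rs), S))"
    (is "?l \<longleftrightarrow> ?r")
proof -
  have all2: "(\<forall>i j. P i j) \<longleftrightarrow>
      P 0 0 \<and> (\<forall>j. P 0 (Suc j)) \<and> (\<forall>i. P (Suc i) 0) \<and> (\<forall>i j. P (Suc i) (Suc j))"
    for P :: "nat \<Rightarrow> nat \<Rightarrow> bool"
    using nat.exhaust by metis
  have sub: "S' \<subseteq> shifted_cells (Suc k, map Suc rs) \<longleftrightarrow>
      S \<subseteq> shifted_cells (k, rs) \<and> (\<forall>i\<in>C. i < Suc (k + length rs))"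
    by (auto simp: S'_def shifted_cells_add_column)
  have cols: "(\<forall>j<Suc k. \<exists>i. (i, j) \<in> S') \<longleftrightarrow> C \<noteq> {} \<and> (\<forall>j<k. \<exists>i. (i, j) \<in> S)"
    (is "?a \<longleftrightarrow> ?b")
  proof -
    have "(\<exists>i. (i, Suc j) \<in> S') \<longleftrightarrow> (\<exists>i. (i, j) \<in> S)" for j
      using mem_add_column by (metis nat.exhaust)
    moreover have "(\<exists>i. (i, 0) \<in> S') \<longleftrightarrow> C \<noteq> {}" by (auto simp: mem_add_column)
    ultimately show ?thesis by (simp add: All_less_Suc2)
  qed
  have zeros: "(\<forall>i j. (i, j) \<in> shifted_cells (Suc k, map Suc rs) \<longrightarrow> (i, j) \<notin> S' \<longrightarrow>
        \<not> (one_above S' (i, j) \<and> one_left S' (i, j))) \<longleftrightarrow>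
     (\<forall>i j. (i, j) \<in> shifted_cells (k, rs) \<longrightarrow> (i, j) \<notin> S \<longrightarrow>
        \<not> (one_above S (i, j) \<and> (one_left S (i, j) \<or> Suc i \<in> C)))"
    by (subst all2)
      (simp add: shifted_cells_add_column mem_add_column one_above_add_column one_left_add_column)
  have diag: "(\<forall>i<Suc k. (i, i) \<notin> S' \<longrightarrow> \<not> one_left S' (i, i)) \<longleftrightarrow>
     (\<forall>i<k. (i, i) \<notin> S \<longrightarrow> \<not> (one_left S (i, i) \<or> Suc i \<in> C))"
    by (simp add: All_less_Suc2 mem_add_column one_left_add_column)
  have C: "C \<subseteq> insert 0 (Suc ` free_rows ((k, rs), S)) \<longleftrightarrow>
     (\<forall>i. Suc i \<in> C \<longrightarrow> i \<in> free_rows ((k, rs), S))"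
    by (auto simp: subset_iff image_iff) (metis nat.exhaust)
  have Cl: "(\<forall>i\<in>C. i < Suc (k + length rs)) \<longleftrightarrow> (\<forall>i. Suc i \<in> C \<longrightarrow> i < k + length rs)"
    by (metis Suc_less_eq nat.exhaust zero_less_Suc)
  have srt: "sorted_wrt (\<ge>) (map Suc rs) \<longleftrightarrow> sorted_wrt (\<ge>) rs"
    by (simp add: sorted_wrt_map)
  show ?thesis
    unfolding PT_B_iff sub cols zeros diag C Cl srt free_rows_iff
    by (simp; blast)
qed

end

lemma add_column_in_PT_B_iff:
  "add_column T C \<in> PT_B (Suc n) \<longleftrightarrow>
     T \<in> PT_B n \<and> C \<noteq> {} \<and> C \<subseteq> insert 0 (Suc ` free_rows T)"
  by (cases T rule: prod.exhaust, rename_tac F S, case_tac F)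
    (simp add: add_column_def add_column_in_PT_B_iff_aux)

lemma inj_add_column: "inj (\<lambda>(T, C). add_column T C)"
proof (rule injI, clarify)
  fix k rs S C k' rs' S' C'
  assume "add_column ((k, rs), S) C = add_column ((k', rs'), S') C'"
  then have kr: "k = k'" "map Suc rs = map Suc rs'"
    and eq: "map_prod Suc Suc ` S \<union> (\<lambda>i. (i, 0)) ` C = map_prod Suc Suc ` S' \<union> (\<lambda>i. (i, 0)) ` C'"
    by (simp_all add: add_column_def)
  have "rs = rs'" using kr(2) by (simp add: inj_map_eq_map)
  moreover have "S = S'"
    using mem_add_column(1)[of _ _ S C] mem_add_column(1)[of _ _ S' C'] unfolding eq by auto
  moreover have "C = C'"
    using mem_add_column(3)[of _ S C] mem_add_column(3)[of _ S' C'] unfolding eq by auto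
  ultimately show "((k, rs), S) = ((k', rs'), S') \<and> C = C'" using kr by simp
qed

lemma row_stat_add_column: "row_stat (add_column T C) = row_stat T"
  by (auto simp: add_column_def row_stat_def split: prod.splits)

lemma diag_stat_add_column:
  "diag_stat (add_column T C) = diag_stat T + (if 0 \<in> C then 1 else 0)"
proof -
  obtain k rs S where T: "T = ((k, rs), S)" by (metis prod.exhaust)
  have fin: "finite (diagonal_cells (k, rs))"
    by (rule finite_subset[of _ "(\<lambda>i. (i, i)) ` {..<k}"]) (auto simp: diagonal_cells_def)
  have inj: "inj (map_prod Suc Suc)" by (auto simp: inj_def)
  have "(map_prod Suc Suc ` S \<union> (\<lambda>i. (i, 0)) ` C) \<inter> diagonal_cells (Suc k, map Suc rs) =
      map_prod Suc Suc ` (S \<inter> diagonal_cells (k, rs)) \<union> (if 0 \<in> C then {(0, 0)} else {})"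
    (is "_ = ?A \<union> ?B")
    by (auto simp: diagonal_cells_iff image_iff map_prod_def split: prod.splits)
  moreover have "card (?A \<union> ?B) = card ?A + card ?B"
    using fin by (intro card_Un_disjoint) auto
  moreover have "card ?A = card (S \<inter> diagonal_cells (k, rs))"
    using inj by (intro card_image) (auto intro: inj_on_subset)
  ultimately show ?thesis
    by (simp add: T add_column_def diag_stat_def)
qed

text \<open>In the new column every 1 except the topmost has a 1 above it; in the old columns
  nothing changes.\<close>

lemma so_stat_add_column:
  assumes "finite (snd T)" "finite C" "C \<noteq> {}"
  shows "so_stat (add_column T C) = so_stat T + (card C - 1)"
proof -
  obtain k rs S where T: "T = ((k, rs), S)" by (metis prod.exhaust)
  let ?S' = "map_prod Suc Suc ` S \<union> (\<lambda>i. (i, 0)) ` C"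
  have inj: "inj (map_prod Suc Suc)" by (auto simp: inj_def)
  have "{c \<in> ?S'. one_above ?S' c} =
      map_prod Suc Suc ` {c \<in> S. one_above S c} \<union> (\<lambda>i. (i, 0)) ` (C - {Min C})"
    (is "_ = ?A \<union> ?B")
  proof -
    have "(\<exists>c\<in>C. c < i) \<longleftrightarrow> i \<noteq> Min C" if "i \<in> C" for i
      using that assms by (metis Min_in Min_le le_neq_implies_less not_less)
    then show ?thesis
      by (auto simp: one_above_add_column)
  qed
  moreover have "card (?A \<union> ?B) = card ?A + card ?B"
    using assms by (intro card_Un_disjoint) (auto simp: T)
  moreover have "card ?A = card {c \<in> S. one_above S c}"
    using inj by (intro card_image) (auto intro: inj_on_subset)
  moreover have "card ?B = card C - 1"
    using assms by (subst card_image) (auto simp: inj_on_def)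
  ultimately show ?thesis
    by (simp add: T add_column_def so_stat_def)
qed

text \<open>A row with a 1 in the new column stays free; a free row with a 0 there stays free only
  if no 1 of the column lies above that 0. Row 0 is free only if its diagonal cell holds a
  1.\<close>

lemma free_rows_add_column:
  assumes "C \<subseteq> insert 0 (Suc ` free_rows T)"
  shows "free_rows (add_column T C) = C \<union> {i \<in> Suc ` free_rows T. \<forall>c\<in>C. i \<le> c}"
proof -
  obtain k rs S where T: "T = ((k, rs), S)" by (metis prod.exhaust)
  let ?S' = "map_prod Suc Suc ` S \<union> (\<lambda>i. (i, 0)) ` C"
  have all_nat: "(\<forall>i. P i) \<longleftrightarrow> P 0 \<and> (\<forall>i. P (Suc i))" for P :: "nat \<Rightarrow> bool"
    using nat.exhaust by metis
  have zero: "0 \<in> free_rows ((Suc k, map Suc rs), ?S') \<longleftrightarrow> 0 \<in> C"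
    by (auto simp: free_rows_iff one_above_add_column)
  have suc: "Suc i \<in> free_rows ((Suc k, map Suc rs), ?S') \<longleftrightarrow>
      i \<in> free_rows T \<and> (Suc i \<in> C \<or> (\<forall>c\<in>C. Suc i \<le> c))" for i
    unfolding free_rows_iff T
    by (subst all_nat)
      (auto simp: shifted_cells_add_column mem_add_column one_above_add_column not_less)
  have "i \<in> free_rows (add_column T C) \<longleftrightarrow> i \<in> C \<or> i \<in> Suc ` free_rows T \<and> (\<forall>c\<in>C. i \<le> c)" for i
  proof (cases i)
    case 0
    then show ?thesis using zero by (auto simp: T add_column_def)
  next
    case (Suc i')
    then show ?thesis
      using suc[of i'] assms by (auto simp: T add_column_def)
  qed
  then show ?thesis by blast
qed

lemma card_free_rows_add_column:
  assumes "C \<subseteq> insert 0 (Suc ` free_rows T)"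
  shows "card (free_rows (add_column T C)) =
    card C + card {i \<in> Suc ` free_rows T. \<forall>c\<in>C. i < c}"
proof -
  have fin: "finite C" using assms finite_free_rows[of T] by (simp add: finite_subset)
  have "C \<union> {i \<in> Suc ` free_rows T. \<forall>c\<in>C. i \<le> c} =
      C \<union> {i \<in> Suc ` free_rows T. \<forall>c\<in>C. i < c}"
    by (auto simp: order.order_iff_strict)
  then show ?thesis
    unfolding free_rows_add_column[OF assms] using fin finite_free_rows[of T]
    by (subst card_Un_disjoint[symmetric]) auto
qed

text \<open>If some row is empty, sortedness makes the last row empty, and dropping it undoes
  \<open>add_row\<close>. Otherwise every row meets the first column, which can be removed together
  with the top row.\<close>

lemma PT_B_Suc_cases:
  assumes "T' \<in> PT_B (Suc n)"
  obtains T where "T' = add_row T" | T C where "T' = add_column T C"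
proof -
  obtain k rs S where T': "T' = ((k, rs), S)" by (metis prod.exhaust)
  have sorted: "sorted_wrt (\<ge>) rs" and le: "\<forall>r\<in>set rs. r \<le> k" and len: "length rs + k = Suc n"
    and sub: "S \<subseteq> shifted_cells (k, rs)"
    using assms by (simp_all add: T' PT_B_iff)
  show thesis
  proof (cases "0 \<in> set rs")
    case True
    then obtain rs' r where rs: "rs = rs' @ [r]" by (cases rs rule: rev_cases) auto
    then have "r = 0" using True sorted by (auto simp: sorted_wrt_append)
    then have "T' = add_row ((k, rs'), S)" by (simp add: T' add_row_def rs)
    then show thesis by (rule that(1))
  next
    case False
    \<comment> \<open>A positive length without columns would force an empty row.\<close>
    have "k \<noteq> 0"
    proof
      assume "k = 0"
      then have "rs \<noteq> []" using len by auto
      then have "hd rs \<in> set rs" by simp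
      then show False using le False \<open>k = 0\<close> by fastforce
    qed
    then obtain k' where k: "k = Suc k'" by (cases k) auto
    have rs: "rs = map Suc (map (\<lambda>r. r - 1) rs)"
      using False by (induction rs) auto
    define rs' where "rs' = map (\<lambda>r. r - 1) rs"
    define S0 where "S0 = {(i, j). (Suc i, Suc j) \<in> S}"
    have "S = map_prod Suc Suc ` S0 \<union> (\<lambda>i. (i, 0)) ` {i. (i, 0) \<in> S}" (is "_ = ?R")
    proof (rule set_eqI, clarify)
      fix i j
      have 0: "(0, Suc j) \<notin> S" for j
        using sub shifted_cells_add_column(2)[of j k' rs'] rs unfolding k rs'_def by auto
      show "(i, j) \<in> S \<longleftrightarrow> (i, j) \<in> ?R"
        using 0 by (cases i; cases j) (auto simp: mem_add_column S0_def)
    qed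
    then have "T' = add_column ((k', rs'), S0) {i. (i, 0) \<in> S}"
      using rs unfolding add_column_def T' k rs'_def by simp
    then show thesis by (rule that(2))
  qed
qed

lemma add_row_neq_add_column: "add_row T \<noteq> add_column T' C"
proof -
  have "0 \<in> set (snd (fst (add_row T)))" "0 \<notin> set (snd (fst (add_column T' C)))"
    by (auto simp: add_row_def add_column_def split: prod.splits)
  then show ?thesis by metis
qed

lemma PT_B_Suc:
  "PT_B (Suc n) = add_row ` PT_B n \<union>
     (\<lambda>(T, C). add_column T C) `
       Sigma (PT_B n) (\<lambda>T. {C. C \<noteq> {} \<and> C \<subseteq> insert 0 (Suc ` free_rows T)})"
  (is "_ = ?R")
proof (rule set_eqI)
  fix T'
  show "T' \<in> PT_B (Suc n) \<longleftrightarrow> T' \<in> ?R"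
  proof
    assume T': "T' \<in> PT_B (Suc n)"
    then show "T' \<in> ?R"
      by (cases rule: PT_B_Suc_cases)
        (use T' in \<open>force simp: add_row_in_PT_B_iff add_column_in_PT_B_iff\<close>)+
  qed (auto simp: add_row_in_PT_B_iff add_column_in_PT_B_iff)
qed

section \<open>Generating function of the tableaux with free rows marked\<close>

lemma PT_B_0: "PT_B 0 = {((0, []), {})}"
proof -
  have "T \<in> PT_B 0 \<longleftrightarrow> T = ((0, []), {})" for T
    by (cases T rule: prod.exhaust, rename_tac F S, case_tac F)
      (auto simp: PT_B_iff shifted_cells_iff)
  then show ?thesis by blast
qed

text \<open>Here \<open>x\<close> is a catalytic variable. All arguments lie in one commutative
  ring, so that a polynomial can be inserted for \<open>x\<close>.\<close>

definition free_row_gf :: "nat \<Rightarrow> 'a::comm_ring_1 \<Rightarrow> 'a \<Rightarrow> 'a \<Rightarrow> 'a" where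
  "free_row_gf n y q x =
     (\<Sum>T\<in>PT_B n. y ^ (2 * row_stat T + diag_stat T) * q ^ so_stat T * x ^ card (free_rows T))"

lemma B_poly_eq_free_row_gf: "B_poly n y 1 q = free_row_gf n y q 1"
  by (simp add: B_poly_def free_row_gf_def)

lemma free_row_gf_0: "free_row_gf 0 y q x = 1"
proof -
  have "row_stat ((0, []), {}) = 0" "diag_stat ((0, []), {}) = 0" "so_stat ((0, []), {}) = 0"
    "free_rows ((0, []), {}) = {}"
    by (auto simp: row_stat_def diag_stat_def so_stat_def free_rows_iff)
  then show ?thesis by (simp add: free_row_gf_def PT_B_0)
qed

lemma sum_nonempty_subsets_insert:
  assumes "finite A" "b \<notin> A"
  shows "sum f {C. C \<noteq> {} \<and> C \<subseteq> insert b A} =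
    sum f {C. C \<noteq> {} \<and> C \<subseteq> A} + (\<Sum>C\<in>Pow A. f (insert b C))"
proof -
  have eq: "{C. C \<noteq> {} \<and> C \<subseteq> insert b A} = {C. C \<noteq> {} \<and> C \<subseteq> A} \<union> insert b ` Pow A"
  proof (rule set_eqI)
    fix C
    show "C \<in> {C. C \<noteq> {} \<and> C \<subseteq> insert b A} \<longleftrightarrow> C \<in> {C. C \<noteq> {} \<and> C \<subseteq> A} \<union> insert b ` Pow A"
    proof (cases "b \<in> C")
      case True
      have "C \<in> insert b ` Pow A" if "C \<subseteq> insert b A"
        using that True by (intro image_eqI[of C "insert b" "C - {b}"]) auto
      then show ?thesis using True assms by auto
    next
      case False
      then show ?thesis by auto
    qed
  qed
  have "inj_on (insert b) (Pow A)"
    using assms by (auto simp: inj_on_def)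
  moreover have "finite {C. C \<noteq> {} \<and> C \<subseteq> A}"
    by (rule finite_subset[of _ "Pow A"]) (use assms in auto)
  moreover have "{C. C \<noteq> {} \<and> C \<subseteq> A} \<inter> insert b ` Pow A = {}" using assms by auto
  ultimately show ?thesis
    unfolding eq using assms by (simp add: sum.union_disjoint sum.reindex)
qed

lemma sum_Pow_power_card:
  fixes z :: "'a::comm_ring_1"
  assumes "finite A"
  shows "(\<Sum>C\<in>Pow A. z ^ card C) = (1 + z) ^ card A"
  using assms
proof (induction A rule: finite_induct)
  case (insert b A)
  have "inj_on (insert b) (Pow A)"
    using insert by (auto simp: inj_on_def)
  moreover have "card (insert b C) = Suc (card C)" if "C \<in> Pow A" for C
    using that insert finite_subset[of C A] by (subst card_insert_disjoint) auto
  moreover have "Pow A \<inter> insert b ` Pow A = {}" using insert by auto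
  ultimately show ?case
    using insert by (simp add: Pow_insert sum.union_disjoint sum.reindex o_def
      sum_distrib_left[symmetric] algebra_simps)
qed simp

text \<open>With \<open>b\<close> as the topmost 1 of the column, it contributes \<open>x\<close>,
  and each further 1 contributes \<open>q * x\<close>.\<close>

lemma sum_columns_through_min:
  fixes q x :: "'a::comm_ring_1" and V :: "nat set"
  assumes "finite V" "b \<notin> V"
  shows "(\<Sum>C\<in>Pow V. q ^ (card (insert b C) - 1) * x ^ card (insert b C)) =
    x * (1 + q * x) ^ card V"
proof -
  have "q ^ (card (insert b C) - 1) * x ^ card (insert b C) = x * (q * x) ^ card C"
    if "C \<in> Pow V" for C
  proof -
    have "finite C" "b \<notin> C" using that assms finite_subset[of C V] by auto
    then show ?thesis by (simp add: power_mult_distrib)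
  qed
  then have "(\<Sum>C\<in>Pow V. q ^ (card (insert b C) - 1) * x ^ card (insert b C)) =
      (\<Sum>C\<in>Pow V. x * (q * x) ^ card C)" by (rule sum.cong[OF refl])
  then show ?thesis using assms by (simp add: sum_distrib_left[symmetric] sum_Pow_power_card)
qed

text \<open>Fixing the topmost 1 with \<open>m\<close> rows of \<open>V\<close> below it gives
  \<open>x * (1 + q * x) ^ m\<close>, times an \<open>x\<close> for each row of \<open>V\<close>
  above it, since those stay free. The result is a geometric sum, and the factor on the left is
  \<open>(1 + q * x) - x\<close>. The induction adds a new topmost row.\<close>

lemma sum_columns:
  fixes q x :: "'a::comm_ring_1" and V :: "nat set"
  assumes "finite V"
  shows "(1 + (q - 1) * x) * (\<Sum>C | C \<noteq> {} \<and> C \<subseteq> V.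
      q ^ (card C - 1) * x ^ (card C + card {i \<in> V. \<forall>c\<in>C. i < c})) =
    x * ((1 + q * x) ^ card V - x ^ card V)"
  using assms
proof (induction V rule: finite_linorder_min_induct)
  case (insert b V)
  let ?f = "\<lambda>V C. q ^ (card C - 1) * x ^ (card C + card {i \<in> V. \<forall>c\<in>C. i < c})"
  have b: "b \<notin> V" using insert by auto
  have 1: "?f (insert b V) C = x * ?f V C" if "C \<in> {C. C \<noteq> {} \<and> C \<subseteq> V}" for C
  proof -
    have "{i \<in> insert b V. \<forall>c\<in>C. i < c} = insert b {i \<in> V. \<forall>c\<in>C. i < c}"
      using that insert by auto
    then show ?thesis using b insert by simp
  qed
  have "{i \<in> insert b V. \<forall>c\<in>insert b C. i < c} = {}" for C
    using insert by auto
  then have 2: "(\<Sum>C\<in>Pow V. ?f (insert b V) (insert b C)) = x * (1 + q * x) ^ card V"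
    using sum_columns_through_min[OF insert(1) b] by (simp only: card.empty add_0_right)
  have 3: "sum (?f (insert b V)) {C. C \<noteq> {} \<and> C \<subseteq> V} = x * sum (?f V) {C. C \<noteq> {} \<and> C \<subseteq> V}"
    by (subst sum_distrib_left) (rule sum.cong[OF refl 1])
  have "sum (?f (insert b V)) {C. C \<noteq> {} \<and> C \<subseteq> insert b V} =
      x * sum (?f V) {C. C \<noteq> {} \<and> C \<subseteq> V} + x * (1 + q * x) ^ card V"
    by (simp only: sum_nonempty_subsets_insert[OF insert(1) b] 2 3)
  then have "(1 + (q - 1) * x) * sum (?f (insert b V)) {C. C \<noteq> {} \<and> C \<subseteq> insert b V} =
      x * ((1 + (q - 1) * x) * sum (?f V) {C. C \<noteq> {} \<and> C \<subseteq> V}) +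
      (1 + (q - 1) * x) * (x * (1 + q * x) ^ card V)"
    by (simp only: algebra_simps)
  also have "\<dots> = x * (x * ((1 + q * x) ^ card V - x ^ card V)) +
      (1 + (q - 1) * x) * (x * (1 + q * x) ^ card V)"
    by (simp only: insert.IH)
  also have "\<dots> = x * ((1 + q * x) ^ card (insert b V) - x ^ card (insert b V))"
    using insert b by (simp add: algebra_simps)
  finally show ?case .
qed simp

text \<open>Columns with a 1 in row 0 are counted separately: they carry the diagonal weight
  \<open>y\<close>, and no row lies above their topmost 1.\<close>

lemma sum_all_columns:
  fixes y q x :: "'a::comm_ring_1" and U :: "nat set"
  assumes "finite U"
  shows "(1 + (q - 1) * x) * (\<Sum>C | C \<noteq> {} \<and> C \<subseteq> insert 0 (Suc ` U).
      y ^ (if 0 \<in> C then 1 else 0) * q ^ (card C - 1) *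
      x ^ (card C + card {i \<in> Suc ` U. \<forall>c\<in>C. i < c})) =
    x * ((1 + (q - 1) * x) * y * (1 + q * x) ^ card U + (1 + q * x) ^ card U - x ^ card U)"
proof -
  let ?V = "Suc ` U"
  let ?f = "\<lambda>C. y ^ (if 0 \<in> C then 1 else 0) * q ^ (card C - 1) *
      x ^ (card C + card {i \<in> ?V. \<forall>c\<in>C. i < c})"
  have fin: "finite ?V" and 0: "0 \<notin> ?V" using assms by auto
  have card: "card ?V = card U" by (simp add: card_image)
  have 1: "sum ?f {C. C \<noteq> {} \<and> C \<subseteq> ?V} = (\<Sum>C | C \<noteq> {} \<and> C \<subseteq> ?V.
      q ^ (card C - 1) * x ^ (card C + card {i \<in> ?V. \<forall>c\<in>C. i < c}))"
    by (intro sum.cong) auto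
  have "(\<Sum>C\<in>Pow ?V. ?f (insert 0 C)) = y * (x * (1 + q * x) ^ card ?V)"
    using sum_columns_through_min[of ?V 0 q x] fin 0
    by (simp add: sum_distrib_left[symmetric] mult.assoc)
  then have "(1 + (q - 1) * x) * sum ?f {C. C \<noteq> {} \<and> C \<subseteq> insert 0 ?V} =
      (1 + (q - 1) * x) * sum ?f {C. C \<noteq> {} \<and> C \<subseteq> ?V} +
      (1 + (q - 1) * x) * (y * (x * (1 + q * x) ^ card ?V))"
    by (simp only: sum_nonempty_subsets_insert[OF fin 0] distrib_left)
  also have "\<dots> = x * ((1 + q * x) ^ card ?V - x ^ card ?V) +
      (1 + (q - 1) * x) * (y * (x * (1 + q * x) ^ card ?V))"
    by (simp only: 1 sum_columns[OF fin])
  finally show ?thesis by (simp add: card algebra_simps)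
qed

text \<open>An appended empty row contributes \<open>y\<^sup>2 * x\<close>. Summing over the
  inserted columns turns \<open>x ^ card (free_rows T)\<close> into a combination with
  \<open>(1 + q * x) ^ card (free_rows T)\<close>, whence the substitution. The factor on the left
  replaces a division.\<close>

lemma free_row_gf_Suc:
  fixes y q x :: "'a::comm_ring_1"
  shows "(1 + (q - 1) * x) * free_row_gf (Suc n) y q x =
    x * ((1 + (q - 1) * x) * (y\<^sup>2 * free_row_gf n y q x + y * free_row_gf n y q (1 + q * x)) +
      free_row_gf n y q (1 + q * x) - free_row_gf n y q x)"
proof -
  let ?z = "1 + (q - 1) * x"
  let ?u = "\<lambda>T. y ^ (2 * row_stat T + diag_stat T) * q ^ so_stat T"
  let ?w = "\<lambda>T. ?u T * x ^ card (free_rows T)"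
  let ?Cs = "\<lambda>T. {C. C \<noteq> {} \<and> C \<subseteq> insert 0 (Suc ` free_rows T)}"
  let ?v = "\<lambda>T C. y ^ (if 0 \<in> C then 1 else 0) * q ^ (card C - 1) *
      x ^ (card C + card {i \<in> Suc ` free_rows T. \<forall>c\<in>C. i < c})"
  have finC: "finite (?Cs T)" for T
    by (rule finite_subset[of _ "Pow (insert 0 (Suc ` free_rows T))"])
      (auto simp: finite_free_rows)
  have "free_row_gf (Suc n) y q x =
      sum ?w (add_row ` PT_B n) + sum ?w ((\<lambda>(T, C). add_column T C) ` Sigma (PT_B n) ?Cs)"
    unfolding free_row_gf_def PT_B_Suc
    using finC by (subst sum.union_disjoint)
      (auto simp: finite_PT_B add_row_neq_add_column add_row_neq_add_column[symmetric])
  also have "sum ?w (add_row ` PT_B n) = (\<Sum>T\<in>PT_B n. y\<^sup>2 * x * ?w T)"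
    by (subst sum.reindex)
      (auto simp: inj_on_subset[OF inj_add_row] stats_add_row card_free_rows_add_row
        power_add power2_eq_square mult_ac intro!: sum.cong)
  also have "\<dots> = y\<^sup>2 * x * free_row_gf n y q x"
    by (simp add: free_row_gf_def sum_distrib_left)
  also have "sum ?w ((\<lambda>(T, C). add_column T C) ` Sigma (PT_B n) ?Cs) =
      (\<Sum>(T, C)\<in>Sigma (PT_B n) ?Cs. ?w (add_column T C))"
    by (subst sum.reindex) (auto simp: inj_on_subset[OF inj_add_column] intro!: sum.cong)
  also have "\<dots> = (\<Sum>T\<in>PT_B n. \<Sum>C\<in>?Cs T. ?w (add_column T C))"
    using finC by (simp add: sum.Sigma finite_PT_B)
  also have "\<dots> = (\<Sum>T\<in>PT_B n. ?u T * (\<Sum>C\<in>?Cs T. ?v T C))"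
    unfolding sum_distrib_left
  proof (intro sum.cong refl)
    fix T C assume T: "T \<in> PT_B n" and C: "C \<in> ?Cs T"
    have fin: "finite (snd T)" using T finite_PT_B_filling by (metis prod.collapse)
    have finC: "finite C" using C by (auto intro: finite_subset simp: finite_free_rows)
    show "?w (add_column T C) = ?u T * ?v T C"
      using fin finC C
      by (simp add: row_stat_add_column diag_stat_add_column so_stat_add_column
          card_free_rows_add_column power_add mult_ac)
  qed
  finally have "?z * free_row_gf (Suc n) y q x = ?z * (y\<^sup>2 * x * free_row_gf n y q x) +
      (\<Sum>T\<in>PT_B n. ?u T * (?z * (\<Sum>C\<in>?Cs T. ?v T C)))"
    by (simp add: distrib_left sum_distrib_left mult.left_commute)
  also have "(\<Sum>T\<in>PT_B n. ?u T * (?z * (\<Sum>C\<in>?Cs T. ?v T C))) =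
      (\<Sum>T\<in>PT_B n. ?z * y * x * (?u T * (1 + q * x) ^ card (free_rows T)) +
        x * (?u T * (1 + q * x) ^ card (free_rows T)) - x * ?w T)"
    unfolding sum_all_columns[OF finite_free_rows] by (simp only: algebra_simps)
  also have "\<dots> = ?z * y * x * free_row_gf n y q (1 + q * x) + x * free_row_gf n y q (1 + q * x)
      - x * free_row_gf n y q x"
    by (simp only: free_row_gf_def sum.distrib sum_subtractf sum_distrib_left)
  finally show ?thesis by (simp add: algebra_simps)
qed

section \<open>The growth operator\<close>

text \<open>On the generating function in the variable \<open>z\<close>, the growth of tableaux acts as
  \<open>1 + y\<^sup>2\<close> plus the following operator.\<close>

definition growth_op :: "'a::field \<Rightarrow> 'a \<Rightarrow> 'a poly \<Rightarrow> 'a poly" where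
  "growth_op y q g =
     poly_shift 1 ([:1, -1:] * [:1, y:] * pcompose g [:0, q:] - [:1, 0, y\<^sup>2:] * g)"

text \<open>The right-hand side vanishes at 0, because \<open>g\<close> and its composition with
  \<open>[:0, q:]\<close> agree there. Hence \<open>poly_shift 1\<close> is exact division by the
  variable.\<close>

lemma z_times_growth_op:
  "[:0, 1:] * growth_op y q g = [:1, -1:] * [:1, y:] * pcompose g [:0, q:] - [:1, 0, y\<^sup>2:] * g"
  (is "_ = ?R")
proof -
  have "poly ?R 0 = 0" by (simp add: poly_pcompose)
  then have "coeff ?R 0 = 0" by (simp only: poly_0_coeff_0)
  then have "pCons 0 (poly_shift 1 ?R) = ?R"
    by (intro poly_eqI) (simp add: coeff_pCons coeff_poly_shift del: mult_pCons_left split: nat.split)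
  then show ?thesis by (simp add: growth_op_def)
qed

lemma growth_op_unique:
  "[:0, 1:] * p = [:1, -1:] * [:1, y:] * pcompose g [:0, q:] - [:1, 0, y\<^sup>2:] * g \<Longrightarrow>
    p = growth_op y q g"
  unfolding z_times_growth_op[symmetric] by (metis mult_left_cancel one_neq_zero pCons_eq_0_iff)

lemma growth_op_add: "growth_op y q (g + g') = growth_op y q g + growth_op y q g'"
  by (rule growth_op_unique[symmetric])
    (simp only: distrib_left z_times_growth_op pcompose_add, simp only: algebra_simps)

lemma growth_op_smult: "growth_op y q (smult c g) = smult c (growth_op y q g)"
  by (rule growth_op_unique[symmetric])
    (simp only: mult_smult_right z_times_growth_op pcompose_smult smult_diff_right)

lemma growth_op_sum: "growth_op y q (sum f A) = (\<Sum>i\<in>A. growth_op y q (f i))"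
proof -
  have "growth_op y q 0 = 0" by (simp add: growth_op_def)
  then show ?thesis
    using sum_comp_morphism[of "growth_op y q" f A] by (simp add: growth_op_add o_def)
qed

lemma pcompose_power: "pcompose (p ^ n) r = pcompose p r ^ n"
  by (induction n) (simp_all add: pcompose_mult pcompose_1)

lemma pcompose_free_row_gf:
  "pcompose (free_row_gf n [:y:] [:q:] x) r = free_row_gf n [:y:] [:q:] (pcompose x r)"
  by (simp add: free_row_gf_def pcompose_sum pcompose_mult pcompose_power)

lemma poly_free_row_gf:
  "poly (free_row_gf n [:y:] [:q:] x) a = free_row_gf n y q (poly x a)"
  by (simp add: free_row_gf_def poly_sum)

text \<open>The substitution \<open>x = (1 - z) / (1 - q)\<close> turns \<open>x \<mapsto> 1 + q * x\<close> into \<open>z \<mapsto> q * z\<close>.\<close>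

definition growth_poly :: "nat \<Rightarrow> 'a::field \<Rightarrow> 'a \<Rightarrow> 'a poly" where
  "growth_poly n y q =
     smult ((1 - q) ^ n) (free_row_gf n [:y:] [:q:] (smult (1 / (1 - q)) [:1, -1:]))"

lemma growth_poly_0: "growth_poly 0 y q = 1"
  by (simp add: growth_poly_def free_row_gf_0)

text \<open>Under the substitution \<open>1 + (q - 1) * x\<close> becomes \<open>z\<close>. The
  factor \<open>x = (1 - z) / (1 - q)\<close> of each recurrence step is why
  \<open>growth_poly\<close> is scaled by \<open>(1 - q) ^ n\<close>.\<close>

lemma growth_poly_Suc:
  assumes "q \<noteq> 1"
  shows "growth_poly (Suc n) y q =
    growth_op y q (growth_poly n y q) + smult (1 + y\<^sup>2) (growth_poly n y q)"
proof -
  let ?x = "smult (1 / (1 - q)) [:1, -1:]"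
  let ?A = "\<lambda>n. free_row_gf n [:y:] [:q:] ?x"
  let ?g = "growth_poly n y q" and ?z = "[:0, 1:] :: 'a poly"
  have q: "1 - q \<noteq> 0" using assms by simp
  have z: "1 + ([:q:] - 1) * ?x = ?z"
    using q by (simp add: one_pCons field_simps)
  have qz: "1 + [:q:] * ?x = pcompose ?x [:0, q:]"
    using q by (simp add: one_pCons pcompose_pCons field_simps)
  have scale: "smult a (smult b (x * (z * (u * p + v * p') + p' - p))) =
      smult b x * (z * (u * smult a p + v * smult a p') + smult a p' - smult a p)"
    for a b and x z u v p p' :: "'a poly"
    by (simp add: algebra_simps smult_add_right smult_diff_right)
  have "?z * ?A (Suc n) = ?x * (?z * ([:y:]\<^sup>2 * ?A n + [:y:] * pcompose (?A n) [:0, q:]) +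
      pcompose (?A n) [:0, q:] - ?A n)"
    using free_row_gf_Suc[of "[:q:]" ?x n "[:y:]"] unfolding z unfolding qz pcompose_free_row_gf .
  then have "smult ((1 - q) ^ n) (smult (1 - q) (?z * ?A (Suc n))) =
      smult ((1 - q) ^ n) (smult (1 - q) (?x * (?z * ([:y:]\<^sup>2 * ?A n + [:y:] * pcompose (?A n) [:0, q:]) +
      pcompose (?A n) [:0, q:] - ?A n)))" by (rule arg_cong)
  also have "smult ((1 - q) ^ n) (smult (1 - q) (?z * ?A (Suc n))) = ?z * growth_poly (Suc n) y q"
    by (simp only: growth_poly_def smult_smult mult_smult_right power_Suc2)
  also have "smult ((1 - q) ^ n) (smult (1 - q) (?x * (?z * ([:y:]\<^sup>2 * ?A n + [:y:] * pcompose (?A n) [:0, q:]) +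
      pcompose (?A n) [:0, q:] - ?A n))) =
      smult (1 - q) ?x * (?z * ([:y:]\<^sup>2 * ?g + [:y:] * pcompose ?g [:0, q:]) + pcompose ?g [:0, q:] - ?g)"
    unfolding growth_poly_def pcompose_smult by (rule scale)
  also have "smult (1 - q) ?x = [:1, -1:]" using q by simp
  finally have eq: "?z * growth_poly (Suc n) y q = [:1, -1:] *
      (?z * ([:y:]\<^sup>2 * ?g + [:y:] * pcompose ?g [:0, q:]) + pcompose ?g [:0, q:] - ?g)" .
  have const_eqs: "[:1, -1:] = 1 - ?z" "[:1, y:] = 1 + [:y:] * ?z" "[:1, 0, y\<^sup>2:] = 1 + [:y:]\<^sup>2 * ?z\<^sup>2"
    "[:1 + y\<^sup>2:] = 1 + [:y:]\<^sup>2"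
    by (simp_all add: one_pCons power2_eq_square)
  \<comment> \<open>The scalar part splits off by (1 - z) * (y^2 * z - 1) = (1 + y^2) * z - (1 + y^2
    * z^2).\<close>
  have "?z * (growth_poly (Suc n) y q - [:1 + y\<^sup>2:] * ?g) =
      [:1, -1:] * [:1, y:] * pcompose ?g [:0, q:] - [:1, 0, y\<^sup>2:] * ?g"
    unfolding right_diff_distrib eq unfolding const_eqs by (simp only: algebra_simps power2_eq_square mult_1)
  from growth_op_unique[OF this] show ?thesis by (simp add: algebra_simps)
qed

text \<open>Chebyshev-like polynomials in the operator, applied to 1: the operator acts on them as
  the step operator of weighted Motzkin paths.\<close>

fun level_poly :: "'a::field \<Rightarrow> 'a \<Rightarrow> nat \<Rightarrow> 'a poly" where
  "level_poly y q 0 = 1"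
| "level_poly y q (Suc 0) = growth_op y q 1"
| "level_poly y q (Suc (Suc k)) =
     growth_op y q (level_poly y q (Suc k)) - smult (y\<^sup>2) (level_poly y q k)"

section \<open>Coefficientwise homomorphisms and the generating series of the level
  polynomials\<close>

definition fps_map :: "('a \<Rightarrow> 'b) \<Rightarrow> 'a fps \<Rightarrow> 'b fps" where
  "fps_map f F = Abs_fps (\<lambda>n. f (fps_nth F n))"

lemma fps_nth_fps_map: "fps_nth (fps_map f F) n = f (fps_nth F n)"
  by (simp add: fps_map_def)

text \<open>It is used for the substitution of \<open>q * z\<close> for \<open>z\<close> and for
  evaluation at \<open>q\<close>.\<close>

locale coeff_hom =
  fixes f :: "'a::comm_ring_1 \<Rightarrow> 'b::comm_ring_1"
  assumes add: "f (a + b) = f a + f b"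
    and mult: "f (a * b) = f a * f b"
    and one: "f 1 = 1"
begin

lemma zero: "f 0 = 0"
  using add[of 0 0] by simp

lemma diff: "f (a - b) = f a - f b"
  using add[of "a - b" b] by simp

lemma fps_map_simps:
  "fps_map f (F + G) = fps_map f F + fps_map f G"
  "fps_map f (F - G) = fps_map f F - fps_map f G"
  "fps_map f (F * G) = fps_map f F * fps_map f G"
  "fps_map f 1 = 1"
  "fps_map f 0 = 0"
  "fps_map f fps_X = fps_X"
  "fps_map f (fps_const c) = fps_const (f c)"
proof -
  have "f (\<Sum>i=0..n. fps_nth F i * fps_nth G (n - i)) =
      (\<Sum>i=0..n. f (fps_nth F i) * f (fps_nth G (n - i)))" for n
    using sum_comp_morphism[of f "\<lambda>i. fps_nth F i * fps_nth G (n - i)" "{0..n}"]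
    by (simp add: zero add mult o_def)
  then show "fps_map f (F * G) = fps_map f F * fps_map f G"
    by (simp add: fps_eq_iff fps_nth_fps_map fps_mult_nth)
qed (auto simp: fps_eq_iff fps_nth_fps_map add diff zero one fps_X_def)

end

text \<open>This is \<open>H(z, s * w)\<close>, with \<open>fps_X\<close> as \<open>w\<close>; the
  values \<open>s = 1\<close> and \<open>s = q\<close> are compared later.\<close>

definition level_fps :: "'a::field \<Rightarrow> 'a \<Rightarrow> 'a \<Rightarrow> 'a poly fps" where
  "level_fps y q s = Abs_fps (\<lambda>k. smult (s ^ k) (level_poly y q k))"

text \<open>The recurrence of \<open>level_poly\<close> is multiplied by \<open>z\<close> and
  summed; \<open>z_times_growth_op\<close> then trades the operator for the substitution of
  \<open>q * z\<close>.\<close>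

lemma level_fps_eq:
  fixes y q s :: "'a::field"
  defines "Y \<equiv> fps_const [:y:]" and "S \<equiv> fps_const [:s:]" and "z \<equiv> fps_const [:0, 1:]"
  shows "(S * fps_X + z) * (1 + Y\<^sup>2 * S * fps_X * z) * level_fps y q s =
    z + S * fps_X * (1 - z) * (1 + Y * z) *
      fps_map (\<lambda>p. pcompose p [:0, q:]) (level_fps y q s)"
proof -
  let ?H = "level_fps y q s" and ?h = "level_poly y q"
  let ?Hq = "fps_map (\<lambda>p. pcompose p [:0, q:]) ?H"
  have op: "[:1, -1:] * [:1, y:] * pcompose g [:0, q:] = [:0, 1:] * growth_op y q g + [:1, 0, y\<^sup>2:] * g" for g
    by (simp only: z_times_growth_op) simp
  have 1: "fps_const [:0, 1:] * ?H + fps_X * (fps_const ([:s:] * [:1, 0, y\<^sup>2:]) * ?H) +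
      fps_X * (fps_X * (fps_const ([:s:] * [:s:] * [:y:] * [:y:] * [:0, 1:]) * ?H)) =
    fps_const [:0, 1:] + fps_X * (fps_const ([:s:] * ([:1, -1:] * [:1, y:])) * ?Hq)"
    (is "?l = ?r")
  proof (rule fps_ext)
    fix n
    have smult: "[:s:] * p = smult s p" for p by simp
    have r: "fps_nth ?r n = (if n = 0 then [:0, 1:] else
        smult s (smult (s ^ (n - 1)) ([:0, 1:] * growth_op y q (?h (n - 1)) + [:1, 0, y\<^sup>2:] * ?h (n - 1))))"
      by (simp only: op[symmetric])
        (simp add: level_fps_def fps_nth_fps_map pcompose_smult smult mult.commute del: mult_pCons_left mult_pCons_right)
    show "fps_nth ?l n = fps_nth ?r n"
    proof (cases n)
      case (Suc m)
      show ?thesis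
        unfolding r by (cases m)
          (simp_all add: Suc level_fps_def algebra_simps smult_add_right smult_diff_right power2_eq_square)
    qed (simp only: r, simp add: level_fps_def)
  qed
  have const_eqs: "fps_const ([:s:] * [:1, 0, y\<^sup>2:]) = S * (1 + Y\<^sup>2 * z\<^sup>2)"
    "fps_const ([:s:] * [:s:] * [:y:] * [:y:] * [:0, 1:]) = S * S * Y * Y * z"
    "fps_const ([:s:] * ([:1, -1:] * [:1, y:])) = S * (1 - z) * (1 + Y * z)"
    by (simp_all add: Y_def S_def z_def fps_const_1_eq_1[symmetric] one_pCons power2_eq_square
        algebra_simps del: fps_const_1_eq_1)
  show ?thesis
    using 1 unfolding const_eqs unfolding z_def[symmetric]
    by (simp add: algebra_simps power2_eq_square)
qed

section \<open>Evaluation at \<open>z = q\<close>\<close>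

text \<open>Zeilberger-type certificate: passing from \<open>w\<close> to \<open>q * w\<close> changes the coefficient of the
  \<open>z\<close>-recurrence by a rational factor, so a combination of the two series solves the homogeneous
  recurrence.\<close>

lemma certificate:
  fixes w z Y Q H Hq H1 H1q :: "'a::comm_ring_1"
  assumes 1: "(w + z) * (1 + Y\<^sup>2 * w * z) * H = z + w * (1 - z) * (1 + Y * z) * Hq"
      (is "?l1 = ?r1")
    and 2: "(Q * w + z) * (1 + Y\<^sup>2 * Q * w * z) * H1 = z + Q * w * (1 - z) * (1 + Y * z) * H1q"
      (is "?l2 = ?r2")
  shows "(w + z) * (1 + Y\<^sup>2 * w * (Q * z)) *
      ((1 + w) * (1 - w * Y) * (1 + Y\<^sup>2 * w * z) * H +
       w * Y * (1 + Y\<^sup>2 * Q * w) * (1 - Y * Q * w) * (Q * w + z) * H1 - (1 - Y\<^sup>2 * Q * w\<^sup>2)) =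
    w * (1 - z) * (1 + Y * z) *
      ((1 + w) * (1 - w * Y) * (1 + Y\<^sup>2 * w * (Q * z)) * Hq +
       w * Y * (1 + Y\<^sup>2 * Q * w) * (1 - Y * Q * w) * (Q * w + Q * z) * H1q - (1 - Y\<^sup>2 * Q * w\<^sup>2))"
    (is "?l = ?r")
proof -
  let ?p = "(w + z) * (1 + Y\<^sup>2 * w * (Q * z))" and ?k = "w * (1 - z) * (1 + Y * z)"
  let ?A = "(1 + w) * (1 - w * Y)" and ?B = "w * Y * (1 + Y\<^sup>2 * Q * w) * (1 - Y * Q * w)"
  let ?C = "1 - Y\<^sup>2 * Q * w\<^sup>2"
  have "?p * (?A * (1 + Y\<^sup>2 * w * z) * H) = ?A * (1 + Y\<^sup>2 * w * (Q * z)) * ?l1"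
    by (simp only: mult_ac)
  also have "\<dots> = ?A * (1 + Y\<^sup>2 * w * (Q * z)) * z + ?k * (?A * (1 + Y\<^sup>2 * w * (Q * z)) * Hq)"
    unfolding 1 distrib_left[of _ z] by (simp only: mult_ac)
  finally have H: "?p * (?A * (1 + Y\<^sup>2 * w * z) * H) = \<dots>" .
  \<comment> \<open>The factor \<open>1 + Y\<^sup>2 * w * (Q * z)\<close> of \<open>?p\<close>
    already belongs to the second recurrence, so only \<open>w + z\<close> is left over.\<close>
  have "?p * (?B * (Q * w + z) * H1) = ?B * (w + z) * ?l2"
    by (simp only: mult_ac)
  also have "\<dots> = ?B * (w + z) * z + ?k * (?B * (Q * (w + z)) * H1q)"
    unfolding 2 distrib_left[of _ z] by (simp only: mult_ac)
  finally have H1: "?p * (?B * (Q * w + z) * H1) = ?B * (w + z) * z + ?k * (?B * (Q * w + Q * z) * H1q)"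
    by (simp only: distrib_left)
  \<comment> \<open>The inhomogeneous terms of both recurrences are absorbed by \<open>?C\<close>,
    which makes the combined equation homogeneous.\<close>
  have C: "?A * (1 + Y\<^sup>2 * w * (Q * z)) * z + ?B * (w + z) * z - ?p * ?C = - (?k * ?C)"
    by (simp add: algebra_simps power2_eq_square)
  have "?l = (?A * (1 + Y\<^sup>2 * w * (Q * z)) * z + ?B * (w + z) * z - ?p * ?C) +
      (?k * (?A * (1 + Y\<^sup>2 * w * (Q * z)) * Hq) + ?k * (?B * (Q * w + Q * z) * H1q))"
    unfolding right_diff_distrib[of ?p] distrib_left[of ?p] H H1 by (simp only: add_ac diff_conv_add_uminus)
  also have "\<dots> = ?r"
    unfolding C right_diff_distrib[of ?k] distrib_left[of ?k] by (simp only: add_ac diff_conv_add_uminus)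
  finally show ?thesis .
qed

lemma coeff_hom_pcompose: "coeff_hom (\<lambda>p :: 'a::field poly. pcompose p r)"
  by unfold_locales (simp_all add: pcompose_add pcompose_mult pcompose_1)

lemma coeff_hom_poly: "coeff_hom (\<lambda>p :: 'a::field poly. poly p a)"
  by unfold_locales simp_all

text \<open>Comparing coefficients expresses \<open>z\<close> times the \<open>n\<close>-th
  coefficient through the two preceding ones, and multiplication by \<open>z\<close> is
  injective.\<close>

lemma fps_eq_0_if_z_recurrence:
  fixes V :: "'a::field poly fps"
  defines "z \<equiv> fps_const [:0, 1:]"
  assumes "(fps_X + z) * (1 + fps_const a * fps_X) * V = fps_X * fps_const b * fps_map f V"
    and f: "f 0 = 0"
  shows "V = 0"
proof -
  have eq: "fps_const [:0, 1:] * V + fps_X * ((1 + fps_const ([:0, 1:] * a)) * V) + fps_X * (fps_X * (fps_const a * V)) =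
      fps_X * (fps_const b * fps_map f V)"
    using assms(2) unfolding fps_const_mult[symmetric] z_def by (simp only: algebra_simps mult_1)
  have "fps_nth V n = 0" for n
  proof (induction n rule: less_induct)
    case (less n)
    have one: "1 + fps_const ([:0, 1:] * a) = fps_const (1 + [:0, 1:] * a)"
      by (simp flip: fps_const_1_eq_1)
    have "fps_nth (fps_const [:0, 1:] * V) n = 0"
      using arg_cong[OF eq, of "\<lambda>F. fps_nth F n"] less unfolding one
      by (cases n; cases "n - 1") (simp_all add: fps_nth_fps_map f)
    then show ?case by simp
  qed
  then show ?thesis by (simp add: fps_eq_iff)
qed

text \<open>The difference of the two sides solves a homogeneous recurrence by
  \<open>certificate\<close> and is therefore 0. No shift in \<open>z\<close> remains, so
  \<open>z\<close> can be specialized.\<close>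

lemma level_fps_w_recurrence:
  fixes y q :: "'a::field"
  defines "Y \<equiv> fps_const [:y:]" and "Q \<equiv> fps_const [:q:]" and "z \<equiv> fps_const [:0, 1:]"
    and "w \<equiv> fps_X"
  shows "(1 + w) * (1 - w * Y) * (1 + Y\<^sup>2 * w * z) * level_fps y q 1 +
      w * Y * (1 + Y\<^sup>2 * Q * w) * (1 - Y * Q * w) * (Q * w + z) * level_fps y q q =
      1 - Y\<^sup>2 * Q * w\<^sup>2"
proof -
  interpret coeff_hom "\<lambda>p. pcompose p [:0, q:]" by (rule coeff_hom_pcompose)
  let ?\<sigma> = "fps_map (\<lambda>p. pcompose p [:0, q:])"
  let ?H = "level_fps y q 1" and ?H1 = "level_fps y q q"
  let ?V = "(1 + w) * (1 - w * Y) * (1 + Y\<^sup>2 * w * z) * ?H +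
      w * Y * (1 + Y\<^sup>2 * Q * w) * (1 - Y * Q * w) * (Q * w + z) * ?H1 - (1 - Y\<^sup>2 * Q * w\<^sup>2)"
  have S1: "fps_const [:1 :: 'a:] = 1" by (simp flip: one_pCons)
  have \<sigma>: "?\<sigma> w = w" "?\<sigma> z = Q * z" "?\<sigma> Y = Y" "?\<sigma> Q = Q"
    by (simp_all add: Y_def Q_def z_def w_def fps_map_simps pcompose_pCons)
  have "?\<sigma> ?V = (1 + w) * (1 - w * Y) * (1 + Y\<^sup>2 * w * (Q * z)) * ?\<sigma> ?H +
      w * Y * (1 + Y\<^sup>2 * Q * w) * (1 - Y * Q * w) * (Q * w + Q * z) * ?\<sigma> ?H1 - (1 - Y\<^sup>2 * Q * w\<^sup>2)"
    by (simp only: fps_map_simps(1-5) \<sigma> power2_eq_square)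
  then have "(w + z) * (1 + Y\<^sup>2 * w * (Q * z)) * ?V = w * (1 - z) * (1 + Y * z) * ?\<sigma> ?V"
    using certificate[of w z Y ?H "?\<sigma> ?H" Q ?H1 "?\<sigma> ?H1", OF
      level_fps_eq[of 1 y q, unfolded S1 mult_1 mult_1_right, folded Y_def z_def w_def]
      level_fps_eq[of q y q, folded Y_def Q_def z_def w_def]]
    by (simp only:)
  moreover have "1 + Y\<^sup>2 * w * (Q * z) = 1 + fps_const ([:y:]\<^sup>2 * [:q:] * [:0, 1:]) * w"
    by (simp only: Y_def Q_def z_def fps_const_mult[symmetric] fps_const_power[symmetric] mult_ac)
  moreover have "w * (1 - z) * (1 + Y * z) = w * fps_const ((1 - [:0, 1:]) * (1 + [:y:] * [:0, 1:]))"
    by (simp add: Y_def z_def flip: fps_const_1_eq_1)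
  ultimately have "(w + z) * (1 + fps_const ([:y:]\<^sup>2 * [:q:] * [:0, 1:]) * w) * ?V =
      w * fps_const ((1 - [:0, 1:]) * (1 + [:y:] * [:0, 1:])) * ?\<sigma> ?V"
    by (simp only:)
  from fps_eq_0_if_z_recurrence[OF this[unfolded w_def z_def], folded w_def z_def, OF zero]
  have "?V = 0" .
  then show ?thesis by simp
qed

section \<open>The inner sums and the values of the level polynomials at \<open>q\<close>\<close>

definition theta_sum :: "'a::comm_ring_1 \<Rightarrow> 'a \<Rightarrow> nat \<Rightarrow> 'a" where
  "theta_sum y q j = (\<Sum>l=0..2*j. y ^ l * q ^ (l * (2*j - l + 1) div 2))"

lemma theta_sum_0: "theta_sum y q 0 = 1"
  by (simp add: theta_sum_def)

text \<open>With \<open>d = 2 * j - l\<close> this rests on (l + 1) * (d + 2) = l * (d + 1) + 2 * (j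
  + 1).\<close>

lemma theta_exponent_Suc:
  fixes j l :: nat
  assumes "l \<le> 2 * j"
  shows "Suc l * (2 * Suc j - Suc l + 1) div 2 = Suc j + l * (2 * j - l + 1) div 2"
proof -
  obtain d where d: "2 * j = l + d" using assms le_Suc_ex by blast
  have "2 * Suc j - Suc l + 1 = d + 2" "2 * j - l + 1 = d + 1" "2 * Suc j = l + d + 2"
    using d by simp_all
  moreover have "Suc l * (d + 2) = (l + d + 2) + l * (d + 1)" by simp
  ultimately have "Suc l * (2 * Suc j - Suc l + 1) = l * (2 * j - l + 1) + Suc j * 2"
    by (simp only: mult.commute add.commute)
  moreover have "(a + b * 2) div 2 = b + a div 2" for a b :: nat by simp
  ultimately show ?thesis by (simp only:)
qed

text \<open>The two end terms split off; shifting \<open>l\<close> by one maps the interior to the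
  sum for \<open>j\<close>, each exponent of \<open>q\<close> growing by
  \<open>Suc j\<close>.\<close>

lemma theta_sum_Suc:
  "theta_sum y q (Suc j) = 1 + y ^ (2 * Suc j) * q ^ Suc j + y * q ^ Suc j * theta_sum y q j"
proof -
  define E where "E j l = l * (2 * j - l + 1) div 2" for j l :: nat
  have E: "theta_sum y q j = (\<Sum>l\<le>2*j. y ^ l * q ^ E j l)" for j
    by (simp only: theta_sum_def E_def atLeast0AtMost)
  have E_0: "E (Suc j) 0 = 0" by (simp add: E_def)
  have E_Suc: "E (Suc j) (Suc l) = Suc j + E j l" if "l \<le> 2 * j" for l
    unfolding E_def by (rule theta_exponent_Suc[OF that])
  have E_last: "E (Suc j) (Suc (Suc (2 * j))) = Suc j" by (simp add: E_def)
  have "2 * Suc j = Suc (Suc (2 * j))" by simp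
  then have "theta_sum y q (Suc j) = (\<Sum>l\<le>Suc (Suc (2*j)). y ^ l * q ^ E (Suc j) l)"
    by (simp only: E)
  also have "\<dots> = 1 + (\<Sum>l\<le>Suc (2*j). y ^ Suc l * q ^ E (Suc j) (Suc l))"
    by (subst sum.atMost_Suc_shift) (simp only: E_0 power_0 mult_1)
  also have "\<dots> = 1 + ((\<Sum>l\<le>2*j. y ^ Suc l * q ^ (Suc j + E j l)) + y ^ (2 * Suc j) * q ^ Suc j)"
    using E_Suc E_last by simp
  also have "(\<Sum>l\<le>2*j. y ^ Suc l * q ^ (Suc j + E j l)) = y * q ^ Suc j * theta_sum y q j"
    by (simp add: E sum_distrib_left power_add mult_ac)
  finally show ?thesis by (simp only: add_ac)
qed

text \<open>At \<open>z = q\<close> both terms of \<open>level_fps_w_recurrence\<close> share the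
  factor \<open>(1 + w) * (1 + y\<^sup>2 * q * w)\<close>. What remains relates a series at
  \<open>w\<close> and at \<open>q * w\<close> and has only one solution; \<open>?F\<close> solves
  it, and so does \<open>(1 - y * w)\<close> times the series of the level values.\<close>

lemma poly_level_poly:
  fixes y q :: "'a::field"
  shows "poly (level_poly y q k) q = (\<Sum>j=0..k. y ^ (k - j) * (-1) ^ j * theta_sum y q j)"
proof -
  let ?ev = "fps_map (\<lambda>p. poly p q)"
  let ?Y = "fps_const y" and ?Q = "fps_const q" and ?w = "fps_X :: 'a fps"
  let ?g = "\<lambda>k. poly (level_poly y q k) q" and ?G = "\<lambda>j. (-1) ^ j * theta_sum y q j"
  let ?F = "\<lambda>s. Abs_fps (\<lambda>j. s ^ j * ?G j)"
  let ?K = "\<lambda>s. Abs_fps (\<lambda>j. s ^ j * ?g j)"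
  let ?D = "\<lambda>s. (1 - ?Y * fps_const s * ?w) * ?K s - ?F s"
  interpret coeff_hom "\<lambda>p. poly p q" by (rule coeff_hom_poly)
  have K: "?ev (level_fps y q s) = ?K s" for s
    by (simp add: fps_eq_iff fps_nth_fps_map level_fps_def)
  have ev: "?ev (fps_const [:y:]) = ?Y" "?ev (fps_const [:q:]) = ?Q" "?ev (fps_const [:0, 1:]) = ?Q"
    by (simp_all add: fps_map_simps)
  have "(1 + ?w) * (1 - ?w * ?Y) * (1 + ?Y\<^sup>2 * ?w * ?Q) * ?K 1 +
      ?w * ?Y * (1 + ?Y\<^sup>2 * ?Q * ?w) * (1 - ?Y * ?Q * ?w) * (?Q * ?w + ?Q) * ?K q =
      1 - ?Y\<^sup>2 * ?Q * ?w\<^sup>2"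
    using arg_cong[OF level_fps_w_recurrence[of y q], of ?ev]
    by (simp only: fps_map_simps(1-6) ev K power2_eq_square)
  then have XK: "(1 + ?w) * (1 + ?Y\<^sup>2 * ?Q * ?w) *
      ((1 - ?Y * ?w) * ?K 1 + ?w * ?Y * ?Q * ((1 - ?Y * ?Q * ?w) * ?K q)) = 1 - ?Y\<^sup>2 * ?Q * ?w\<^sup>2"
    by (simp only: algebra_simps power2_eq_square mult_1)
  have geom: "(1 + fps_const a * ?w) * Abs_fps (\<lambda>j. (-a) ^ j) = 1" for a
    by (rule fps_ext, rename_tac n, case_tac n) (simp_all add: distrib_right mult.assoc)
  \<comment> \<open>By \<open>theta_sum_Suc\<close> the coefficients for \<open>n > 0\<close> are
    (-1)^n * (1 + y^(2n) * q^n), a sum of two geometric sequences; subtracting 1 corrects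
    \<open>n = 0\<close>.\<close>
  have F: "?F 1 + ?w * ?Y * ?Q * ?F q =
      Abs_fps (\<lambda>j. (-1) ^ j) + Abs_fps (\<lambda>j. (-(y\<^sup>2 * q)) ^ j) - 1" (is "_ = ?A + ?B - 1")
  proof (rule fps_ext)
    fix n
    have "y ^ (2 * n) * q ^ n = (y\<^sup>2 * q) ^ n" by (simp add: power_mult_distrib power_mult)
    moreover have "(-(y\<^sup>2 * q)) ^ n = (-1) ^ n * (y\<^sup>2 * q) ^ n" by (rule power_minus)
    ultimately have B: "(-(y\<^sup>2 * q)) ^ n = (-1) ^ n * (y ^ (2 * n) * q ^ n)" by simp
    have assoc: "?w * ?Y * ?Q * ?F q = ?w * (fps_const (y * q) * ?F q)"
      by (simp add: mult.assoc flip: fps_const_mult)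
    show "fps_nth (?F 1 + ?w * ?Y * ?Q * ?F q) n = fps_nth (?A + ?B - 1) n"
      unfolding assoc fps_add_nth fps_sub_nth fps_nth_Abs_fps B
      by (cases n) (simp_all only: fps_X_mult_nth, simp_all add: theta_sum_0 theta_sum_Suc algebra_simps)
  qed
  have A: "(1 + ?w) * ?A = 1" using geom[of 1] by simp
  have B: "(1 + ?Y\<^sup>2 * ?Q * ?w) * ?B = 1" using geom[of "y\<^sup>2 * q"] by simp
  have "(1 + ?w) * (1 + ?Y\<^sup>2 * ?Q * ?w) * (?A + ?B - 1) =
      (1 + ?Y\<^sup>2 * ?Q * ?w) * ((1 + ?w) * ?A) + (1 + ?w) * ((1 + ?Y\<^sup>2 * ?Q * ?w) * ?B) -
      (1 + ?w) * (1 + ?Y\<^sup>2 * ?Q * ?w)"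
    by (simp only: algebra_simps mult_1)
  also have "\<dots> = 1 - ?Y\<^sup>2 * ?Q * ?w\<^sup>2"
    unfolding A B by (simp add: algebra_simps power2_eq_square)
  finally have "(1 + ?w) * (1 + ?Y\<^sup>2 * ?Q * ?w) * (?F 1 + ?w * ?Y * ?Q * ?F q) =
     1 - ?Y\<^sup>2 * ?Q * ?w\<^sup>2"
    unfolding F .
  moreover have "p * ((u - v) + c * (u' - v')) = p * (u + c * u') - p * (v + c * v')"
    for p c u v u' v' :: "'a fps"
    by (simp add: algebra_simps)
  ultimately have "(1 + ?w) * (1 + ?Y\<^sup>2 * ?Q * ?w) * (?D 1 + ?w * ?Y * ?Q * ?D q) = 0"
    using XK by (simp only: fps_const_1_eq_1 mult_1_right diff_self)
  \<comment> \<open>Both factors have nonzero constant term and can be cancelled.\<close>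
  moreover have "fps_nth (1 + ?w) 0 \<noteq> 0" "fps_nth (1 + ?Y\<^sup>2 * ?Q * ?w) 0 \<noteq> 0" by simp_all
  then have "1 + ?w \<noteq> 0" "1 + ?Y\<^sup>2 * ?Q * ?w \<noteq> 0" by (metis fps_zero_nth)+
  ultimately have D: "?D 1 + ?w * (?Y * ?Q * ?D q) = 0" by (simp add: mult.assoc)
  \<comment> \<open>Hence each coefficient of \<open>?D 1\<close> is a multiple of the preceding
    one, and the constant one is 0.\<close>
  have Dq: "fps_nth (?D q) n = q ^ n * fps_nth (?D 1) n" for n
    by (cases n) (simp_all add: left_diff_distrib mult.assoc algebra_simps)
  have "fps_nth (?D 1) n = 0" for n
  proof (induction n)
    case 0
    show ?case using arg_cong[OF D, of "\<lambda>F. fps_nth F 0"] by simp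
  next
    case (Suc n)
    have "fps_nth (?D 1) (Suc n) + y * q * fps_nth (?D q) n = 0"
      using arg_cong[OF D, of "\<lambda>F. fps_nth F (Suc n)"]
      by (simp only: fps_add_nth fps_X_mult_nth fps_mult_left_const_nth fps_const_mult fps_zero_nth) simp
    then show ?case unfolding Dq Suc by simp
  qed
  moreover have "fps_nth (?D 1) n = ?g n - (if n = 0 then 0 else y * ?g (n - 1)) - ?G n" for n
    by (simp add: left_diff_distrib mult.assoc)
  ultimately have g: "?g n - (if n = 0 then 0 else y * ?g (n - 1)) - ?G n = 0" for n by metis
  have g0: "?g 0 = ?G 0" using g[of 0] by simp
  have gS: "?g (Suc n) = y * ?g n + ?G (Suc n)" for n
    using g[of "Suc n"] by (simp add: algebra_simps)
  show ?thesis
  proof (induction k)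
    case (Suc k)
    have "(\<Sum>j=0..k. y ^ (Suc k - j) * (-1) ^ j * theta_sum y q j) =
        y * (\<Sum>j=0..k. y ^ (k - j) * (-1) ^ j * theta_sum y q j)"
      unfolding sum_distrib_left by (intro sum.cong) (simp_all add: Suc_diff_le)
    then show ?case using Suc gS[of k] by simp
  qed (use g0 in simp)
qed

section \<open>Motzkin path coefficients\<close>

lemma binom_nonneg: "binom n (int b) = n choose b"
  by (auto simp: binom_def binomial_eq_0)

lemma binom_neg: "b < 0 \<Longrightarrow> binom n b = 0"
  by (simp add: binom_def)

lemma binom_gt: "int n < b \<Longrightarrow> binom n b = 0"
  by (simp add: binom_def)

lemma binom_Suc: "binom (Suc n) b = binom n b + binom n (b - 1)"
proof (cases b)
  case (nonneg m)
  show ?thesis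
  proof (cases m)
    case (Suc m')
    then have "b - 1 = int m'" using nonneg by simp
    then show ?thesis by (simp only: nonneg binom_nonneg Suc binomial_Suc_Suc add.commute)
  qed (simp add: nonneg binom_def)
qed (simp add: binom_neg)

text \<open>This is the coefficient of u^k in ((1 + u) * (1 + y^2 / u))^n. Since the base is 1 + y^2
  + u + y^2 / u, it counts weighted Motzkin paths from 0 to \<open>k\<close> that may go below
  0.\<close>

definition binom_corr :: "'a::comm_ring_1 \<Rightarrow> nat \<Rightarrow> int \<Rightarrow> 'a" where
  "binom_corr y n k =
     (\<Sum>i\<le>n. y ^ (2 * i) * (of_nat (binom n (int i)) * of_nat (binom n (int i + k))))"

lemma binom_corr_eq_sum:
  assumes "n \<le> N"
  shows "binom_corr y n k =
    (\<Sum>i\<le>N. y ^ (2 * i) * (of_nat (binom n (int i)) * of_nat (binom n (int i + k))))"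
  unfolding binom_corr_def
  by (rule sum.mono_neutral_left) (use assms in \<open>auto simp: binom_gt\<close>)

lemma binom_corr_shift:
  assumes "n \<le> N"
  shows "(\<Sum>i\<le>Suc N. y ^ (2 * i) * (of_nat (binom n (int i - 1)) * of_nat (binom n (int i - 1 + k)))) =
    y\<^sup>2 * binom_corr y n k"
  unfolding binom_corr_eq_sum[OF assms]
  by (subst sum.atMost_Suc_shift)
    (simp add: binom_neg sum_distrib_left power2_eq_square mult_ac)

lemma binom_corr_eq_0: "int n < k \<Longrightarrow> binom_corr y n k = 0"
  by (simp add: binom_corr_def binom_gt)

text \<open>Pascal's rule in both factors gives four products, one for each term of the base 1 + y^2
  + u + y^2 / u.\<close>

lemma binom_corr_Suc:
  "binom_corr y (Suc n) k =
    (1 + y\<^sup>2) * binom_corr y n k + binom_corr y n (k - 1) + y\<^sup>2 * binom_corr y n (k + 1)"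
proof -
  let ?b = "\<lambda>i. of_nat (binom n i) :: 'a"
  have "binom_corr y (Suc n) k =
      (\<Sum>i\<le>Suc n. y ^ (2 * i) * (?b (int i) * ?b (int i + k))) +
      (\<Sum>i\<le>Suc n. y ^ (2 * i) * (?b (int i) * ?b (int i + (k - 1)))) +
      (\<Sum>i\<le>Suc n. y ^ (2 * i) * (?b (int i - 1) * ?b (int i - 1 + (k + 1)))) +
      (\<Sum>i\<le>Suc n. y ^ (2 * i) * (?b (int i - 1) * ?b (int i - 1 + k)))"
    unfolding binom_corr_def sum.distrib[symmetric]
    by (intro sum.cong refl) (simp add: binom_Suc algebra_simps)
  also have "\<dots> = binom_corr y n k + binom_corr y n (k - 1) + y\<^sup>2 * binom_corr y n (k + 1) +
      y\<^sup>2 * binom_corr y n k"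
    by (simp only: binom_corr_shift[OF order_refl] binom_corr_eq_sum[OF le_SucI[OF order_refl]])
  finally show ?thesis by (simp add: algebra_simps)
qed

text \<open>The base is invariant under exchanging u and y^2 / u; in the sum this is a shift of the
  index by one, which swaps the binomial factors.\<close>

lemma binom_corr_minus_1: "binom_corr y n (-1) = y\<^sup>2 * binom_corr y n 1"
proof -
  have "binom_corr y n (-1) =
      (\<Sum>i\<le>Suc n. y ^ (2 * i) * (of_nat (binom n (int i - 1)) * of_nat (binom n (int i - 1 + 1))))"
    unfolding binom_corr_eq_sum[OF le_SucI[OF order_refl]] by (intro sum.cong refl) (simp add: mult_ac)
  then show ?thesis by (simp only: binom_corr_shift[OF order_refl])
qed

text \<open>Weighted Motzkin path prefixes of length \<open>n\<close> ending at height \<open>k\<close>, by reflection.\<close>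

definition motzkin_gf :: "'a::comm_ring_1 \<Rightarrow> nat \<Rightarrow> int \<Rightarrow> 'a" where
  "motzkin_gf y n k = binom_corr y n k - y\<^sup>2 * binom_corr y n (k + 2)"

lemma motzkin_gf_Suc:
  "motzkin_gf y (Suc n) k =
    (1 + y\<^sup>2) * motzkin_gf y n k + motzkin_gf y n (k - 1) + y\<^sup>2 * motzkin_gf y n (k + 1)"
proof -
  have "k + 2 - 1 = k - 1 + 2" "k + 2 + 1 = k + 1 + 2" by simp_all
  then show ?thesis
    by (simp only: motzkin_gf_def binom_corr_Suc) (simp add: algebra_simps)
qed

text \<open>This is the boundary condition that keeps the paths at nonnegative height.\<close>

lemma motzkin_gf_minus_1: "motzkin_gf y n (-1) = 0"
  by (simp add: motzkin_gf_def binom_corr_minus_1)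

lemma motzkin_gf_eq_0: "int n < k \<Longrightarrow> motzkin_gf y n k = 0"
  by (simp add: motzkin_gf_def binom_corr_eq_0)

text \<open>The factor \<open>y\<^sup>2\<close> of the reflected term is absorbed by an index shift,
  which produces the lower index \<open>i - 1\<close>. Terms beyond \<open>n - k\<close>
  vanish.\<close>

lemma motzkin_gf_eq_sum:
  "motzkin_gf y n (int k) = (\<Sum>i=0..n - k. y ^ (2*i) *
     (of_nat (binom n (int i)) * of_nat (binom n (int i + int k))
      - of_nat (binom n (int i - 1)) * of_nat (binom n (int i + int k + 1))))"
proof -
  let ?f = "\<lambda>i. y ^ (2*i) *
     (of_nat (binom n (int i)) * of_nat (binom n (int i + int k))
      - of_nat (binom n (int i - 1)) * of_nat (binom n (int i + int k + 1)))"
  have shift: "int i - 1 + (int k + 2) = int i + int k + 1" for i by simp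
  have direct: "binom_corr y n (int k) =
      (\<Sum>i\<le>Suc n. y ^ (2 * i) * (of_nat (binom n (int i)) * of_nat (binom n (int i + int k))))"
    by (rule binom_corr_eq_sum) simp
  have reflected: "y\<^sup>2 * binom_corr y n (int k + 2) =
      (\<Sum>i\<le>Suc n. y ^ (2 * i) *
        (of_nat (binom n (int i - 1)) * of_nat (binom n (int i + int k + 1))))"
    using binom_corr_shift[OF order_refl, of y n "int k + 2"] unfolding shift by simp
  have "motzkin_gf y n (int k) = sum ?f {..Suc n}"
    unfolding motzkin_gf_def reflected direct
    by (simp only: sum_subtractf[symmetric] right_diff_distrib)
  also have "\<dots> = sum ?f {0..n - k}"
    by (rule sum.mono_neutral_right) (auto simp: binom_gt)
  finally show ?thesis .
qed

lemma smult_sum_right: "smult c (sum f A) = (\<Sum>i\<in>A. smult c (f i))"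
  by (induction A rule: infinite_finite_induct) (simp_all add: smult_add_right)

text \<open>The operator maps each level polynomial to the next one plus \<open>y\<^sup>2\<close>
  times the previous one. So the coefficients follow the steps of
  \<open>motzkin_gf_Suc\<close>.\<close>

lemma growth_poly_eq_sum:
  fixes y q :: "'a::field"
  assumes "q \<noteq> 1"
  shows "growth_poly n y q = (\<Sum>k\<le>n. smult (motzkin_gf y n (int k)) (level_poly y q k))"
proof (induction n)
  case 0
  have "motzkin_gf y 0 0 = 1"
    by (simp add: motzkin_gf_def binom_corr_def binom_def)
  then show ?case by (simp add: growth_poly_0)
next
  case (Suc n)
  let ?h = "level_poly y q" and ?L = "motzkin_gf y n"
  \<comment> \<open>The value 0 at \<open>k = 0\<close> stands for a level polynomial of index
    -1.\<close>
  let ?pred = "\<lambda>k. if k = 0 then 0 else ?h (k - 1)"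
  have op: "growth_op y q (?h k) = ?h (Suc k) + smult (y\<^sup>2) (?pred k)" for k
    by (cases k) simp_all
  have up: "(\<Sum>k\<le>n. smult (?L (int k)) (?h (Suc k))) = (\<Sum>k\<le>Suc n. smult (?L (int k - 1)) (?h k))"
    by (subst sum.atMost_Suc_shift) (simp add: motzkin_gf_minus_1)
  \<comment> \<open>Two vanishing terms are appended, so that the shifted sum ends at
    \<open>Suc n\<close> like the others.\<close>
  have "(\<Sum>k\<le>n. smult (?L (int k)) (?pred k)) = (\<Sum>k\<le>Suc (Suc n). smult (?L (int k)) (?pred k))"
    by (simp add: motzkin_gf_eq_0)
  also have "\<dots> = (\<Sum>k\<le>Suc n. smult (?L (int k + 1)) (?h k))"
    by (subst sum.atMost_Suc_shift) (simp add: add.commute)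
  finally have down: "(\<Sum>k\<le>n. smult (?L (int k)) (?pred k)) = \<dots>" .
  have same: "(\<Sum>k\<le>n. smult (?L (int k)) (?h k)) = (\<Sum>k\<le>Suc n. smult (?L (int k)) (?h k))"
    by (simp add: motzkin_gf_eq_0)
  have "growth_poly (Suc n) y q =
      (\<Sum>k\<le>n. smult (?L (int k)) (?h (Suc k))) + smult (y\<^sup>2) (\<Sum>k\<le>n. smult (?L (int k)) (?pred k)) +
      smult (1 + y\<^sup>2) (\<Sum>k\<le>n. smult (?L (int k)) (?h k))"
    unfolding growth_poly_Suc[OF assms] Suc growth_op_sum growth_op_smult op
    by (simp add: smult_add_right sum.distrib smult_sum_right mult.commute)
  also have "\<dots> = (\<Sum>k\<le>Suc n. smult (motzkin_gf y (Suc n) (int k)) (?h k))"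
    unfolding up down same motzkin_gf_Suc
    by (simp only: smult_sum_right smult_smult sum.distrib[symmetric] smult_add_left[symmetric] add_ac)
  finally show ?case .
qed

text \<open>The point \<open>z = q\<close> corresponds to \<open>x = 1\<close>, where free rows
  carry no weight.\<close>

lemma B_poly_eq_sum_motzkin_gf:
  fixes y q :: "'a::field"
  assumes "q \<noteq> 1"
  shows "B_poly n y 1 q = 1 / (1 - q) ^ n *
    (\<Sum>k=0..n. motzkin_gf y n (int k) * (\<Sum>j=0..k. y ^ (k - j) * (-1) ^ j * theta_sum y q j))"
proof -
  have q: "1 - q \<noteq> 0" using assms by simp
  have "poly (smult (1 / (1 - q)) [:1, -1:]) q = 1" using q by (simp add: field_simps)
  then have "poly (growth_poly n y q) q = (1 - q) ^ n * B_poly n y 1 q"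
    unfolding growth_poly_def poly_smult poly_free_row_gf B_poly_eq_free_row_gf by (simp only:)
  moreover have "poly (growth_poly n y q) q =
    (\<Sum>k=0..n. motzkin_gf y n (int k) * (\<Sum>j=0..k. y ^ (k - j) * (-1) ^ j * theta_sum y q j))"
    unfolding growth_poly_eq_sum[OF assms] by (simp add: poly_sum poly_level_poly atLeast0AtMost)
  ultimately show ?thesis using q by (simp add: field_simps)
qed

section \<open>Passage to the single sum over \<open>j\<close>\<close>

lemma sum_even_odd:
  "(\<Sum>i=0..2 * m. f i) = (\<Sum>a\<le>m. f (2 * a)) + (\<Sum>a<m. f (2 * a + 1 :: nat))"
  for f :: "nat \<Rightarrow> 'a::comm_monoid_add"
  by (induction m) (simp_all add: ac_simps)

text \<open>Even \<open>i = 2 * a\<close> yields the lower indices \<open>j + a\<close> and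
  \<open>a\<close>; odd \<open>i = 2 * a + 1\<close> yields \<open>j + a + 1\<close> and
  \<open>a\<close> with an extra \<open>y\<close>. The terms cut off are 0.\<close>

lemma binom_corr_parity:
  assumes "j \<le> n"
  shows "(\<Sum>i=0..2*n - 2*j. y ^ i * of_nat (binom n (int (j + (i + 1) div 2)))
      * of_nat (binom n (int (i div 2)))) = binom_corr y n (int j) + y * binom_corr y n (int j + 1)"
    (is "?l = _")
proof -
  let ?f = "\<lambda>i. y ^ i * of_nat (binom n (int (j + (i + 1) div 2))) * of_nat (binom n (int (i div 2)))"
  have "(\<Sum>a\<le>n - j. ?f (2 * a)) = binom_corr y n (int j)"
    unfolding binom_corr_def
  proof (rule sum.mono_neutral_cong_left)
    show "\<forall>i\<in>{..n} - {..n - j}.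
        y ^ (2 * i) * (of_nat (binom n (int i)) * of_nat (binom n (int i + int j))) = 0"
    proof
      fix i assume "i \<in> {..n} - {..n - j}"
      then have "int n < int i + int j" by auto
      then show "y ^ (2 * i) * (of_nat (binom n (int i)) * of_nat (binom n (int i + int j))) = 0"
        by (simp add: binom_gt)
    qed
  qed (auto simp: mult_ac add_ac)
  moreover have "(\<Sum>a<n - j. ?f (2 * a + 1)) = y * binom_corr y n (int j + 1)"
    unfolding binom_corr_def sum_distrib_left
  proof (rule sum.mono_neutral_cong_left)
    show "\<forall>i\<in>{..n} - {..<n - j}.
        y * (y ^ (2 * i) * (of_nat (binom n (int i)) * of_nat (binom n (int i + (int j + 1))))) = 0"
    proof
      fix i assume "i \<in> {..n} - {..<n - j}"
      then have "int n < int i + (int j + 1)" by auto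
      then show "y * (y ^ (2 * i) *
          (of_nat (binom n (int i)) * of_nat (binom n (int i + (int j + 1))))) = 0"
        by (simp add: binom_gt)
    qed
  qed (auto simp: mult_ac add_ac)
  moreover have "2 * n - 2 * j = 2 * (n - j)" by simp
  ultimately show ?thesis by (simp only: sum_even_odd)
qed

text \<open>The sum telescopes: the reflected part of the term for \<open>k\<close> cancels against
  the unreflected part of the term for \<open>k + 2\<close>.\<close>

lemma sum_motzkin_gf:
  assumes "j \<le> n"
  shows "(\<Sum>k=j..n. y ^ (k - j) * motzkin_gf y n (int k)) =
    binom_corr y n (int j) + y * binom_corr y n (int j + 1)"
  using assms
proof (induction j rule: inc_induct)
  case base
  show ?case by (simp add: motzkin_gf_def binom_corr_eq_0)
next
  case (step j)
  have "(\<Sum>k=j..n. y ^ (k - j) * motzkin_gf y n (int k)) =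
      motzkin_gf y n (int j) + (\<Sum>k=Suc j..n. y ^ (k - j) * motzkin_gf y n (int k))"
    using step by (subst sum.atLeast_Suc_atMost) simp_all
  also have "(\<Sum>k=Suc j..n. y ^ (k - j) * motzkin_gf y n (int k)) =
      y * (\<Sum>k=Suc j..n. y ^ (k - Suc j) * motzkin_gf y n (int k))"
    unfolding sum_distrib_left
  proof (intro sum.cong refl)
    fix k assume "k \<in> {Suc j..n}"
    then have "k - j = Suc (k - Suc j)" unfolding atLeastAtMost_iff by arith
    then show "y ^ (k - j) * motzkin_gf y n (int k) =
        y * (y ^ (k - Suc j) * motzkin_gf y n (int k))"
      by (simp only: power_Suc mult.assoc)
  qed
  also have "\<dots> = y * (binom_corr y n (int j + 1) + y * binom_corr y n (int j + 2))"
    using step.IH by (simp add: algebra_simps)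
  finally show ?case by (simp add: motzkin_gf_def algebra_simps power2_eq_square)
qed

theorem theorem1p10:
  fixes n :: nat and y q :: "'a::field"
  assumes "q \<noteq> 1"
  shows "(B_poly n y 1 q =
      1 / (1 - q) ^ n *
      (\<Sum>j=0..n. (-1) ^ j *
         (\<Sum>i=0..2*n - 2*j. y ^ i * of_nat (binom n (int (j + (i + 1) div 2)))
             * of_nat (binom n (int (i div 2)))) *
         (\<Sum>l=0..2*j. y ^ l * q ^ (l * (2*j - l + 1) div 2))))
    \<and> (B_poly n y 1 q =
      1 / (1 - q) ^ n *
      (\<Sum>k=0..n.
         (\<Sum>i=0..n - k. y ^ (2*i) *
            (of_nat (binom n (int i)) * of_nat (binom n (int i + int k))
             - of_nat (binom n (int i - 1)) * of_nat (binom n (int i + int k + 1)))) *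
         (\<Sum>j=0..k. y ^ (k - j) * (-1) ^ j *
            (\<Sum>l=0..2*j. y ^ l * q ^ (l * (2*j - l + 1) div 2)))))"
proof -
  let ?L = "\<lambda>k. motzkin_gf y n (int k)" and ?G = "theta_sum y q"
  have restrict: "(\<Sum>k=0..n. \<Sum>j | j \<in> {0..n} \<and> j \<le> k. f k j) = (\<Sum>k=0..n. \<Sum>j=0..k. f k j)"
    "(\<Sum>j=0..n. \<Sum>k | k \<in> {0..n} \<and> j \<le> k. f k j) = (\<Sum>j=0..n. \<Sum>k=j..n. f k j)"
    for f :: "nat \<Rightarrow> nat \<Rightarrow> 'a"
    by (auto intro!: sum.cong)
  \<comment> \<open>The second form is \<open>B_poly_eq_sum_motzkin_gf\<close> unfolded. For the
    first, the sums over \<open>j \<le> k\<close> are exchanged and the sum over \<open>k\<close> is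
    evaluated by \<open>sum_motzkin_gf\<close>.\<close>
  have "(\<Sum>k=0..n. ?L k * (\<Sum>j=0..k. y ^ (k - j) * (-1) ^ j * ?G j)) =
      (\<Sum>k=0..n. \<Sum>j=0..k. (-1) ^ j * (y ^ (k - j) * ?L k) * ?G j)"
    by (simp add: sum_distrib_left mult_ac)
  also have "\<dots> = (\<Sum>j=0..n. \<Sum>k=j..n. (-1) ^ j * (y ^ (k - j) * ?L k) * ?G j)"
    using sum.swap_restrict[of "{0..n}" "{0..n}"
      "\<lambda>k j. (-1) ^ j * (y ^ (k - j) * ?L k) * ?G j" "\<lambda>k j. j \<le> k"]
    unfolding restrict by simp
  also have "\<dots> = (\<Sum>j=0..n. (-1) ^ j * (\<Sum>k=j..n. y ^ (k - j) * ?L k) * ?G j)"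
    by (simp only: sum_distrib_left sum_distrib_right)
  also have "\<dots> = (\<Sum>j=0..n. (-1) ^ j *
      (\<Sum>i=0..2*n - 2*j. y ^ i * of_nat (binom n (int (j + (i + 1) div 2)))
        * of_nat (binom n (int (i div 2)))) * ?G j)"
    by (intro sum.cong refl) (simp only: sum_motzkin_gf binom_corr_parity atLeastAtMost_iff)
  finally show ?thesis
    using B_poly_eq_sum_motzkin_gf[OF assms, of n y]
    unfolding theta_sum_def motzkin_gf_eq_sum by simp
qed

end
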